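(* Let $n\ge 3$, let $\mathbb{F}$ be $\mathbb{R}$ or $\mathbb{C}$, and let $\phi:M_n(\mathbb{F})\to M_n(\mathbb{F})$ be a bijective map. Then the following are equivalent: (1) $\phi$ is completely quadratic preserving in both directions, i.e. for every $k\in\mathbb{N}$ and every $T\in M_n(\mathbb{F})\otimes M_k$, $T$ is quadratic if and only if $\phi_k(T)$ is quadratic. (2) $\phi$ is 2-quadratic preserving in both directions, i.e. for every $T\in M_n(\mathbb{F})\otimes M_2$, $T$ is quadratic if and only if $\phi_2(T)$ is quadratic. (3) There exist an invertible matrix $A\in M_n(\mathbb{F})$, a scalar $\lambda$ and a field automorphism $\tau:\mathbb{F}\to\mathbb{F}$ such that $\phi(T)=\lambda A T_\tau A^{-1}$ for all $T\in M_n(\mathbb{F})$, where $T_\tau=(\tau(t_{ij}))$ for $T=(t_{ij})$.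
   Context: A square matrix (or block matrix) $T$ is quadratic if there exist scalars $a,b$ with $(T-aI)(T-bI)=0$. For a map $\phi$ on $M_n(\mathbb{F})$ and $k\in\mathbb{N}$, $\phi_k$ acts on $k\times k$ block matrices with entries in $M_n(\mathbb{F})$ by $\phi_k((a_{ij})_{k\times k})=(\phi(a_{ij}))_{k\times k}$. *)

theory Defs
  imports Complex_Main "Jordan_Normal_Form.Matrix"
begin

definition quadratic_mat :: "'a::comm_ring_1 mat \<Rightarrow> bool" where
  "quadratic_mat T \<longleftrightarrow> (\<exists>a b. (T - a \<cdot>\<^sub>m 1\<^sub>m (dim_row T)) * (T - b \<cdot>\<^sub>m 1\<^sub>m (dim_row T))
                                = 0\<^sub>m (dim_row T) (dim_row T))"

text \<open>A k x k block matrix with n x n blocks, i.e. an element of M_n(F) tensor M_k,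
  viewed as a kn x kn matrix.\<close>
definition block_mat :: "nat \<Rightarrow> 'a mat mat \<Rightarrow> 'a mat" where
  "block_mat n B = mat (dim_row B * n) (dim_col B * n)
      (\<lambda>(r, c). (B $$ (r div n, c div n)) $$ (r mod n, c mod n))"

definition block_carrier :: "nat \<Rightarrow> nat \<Rightarrow> 'a mat mat set" where
  "block_carrier n k = {B. B \<in> carrier_mat k k \<and>
      (\<forall>i<k. \<forall>j<k. B $$ (i, j) \<in> carrier_mat n n)}"

definition ampl :: "('a mat \<Rightarrow> 'a mat) \<Rightarrow> 'a mat mat \<Rightarrow> 'a mat mat" where
  "ampl \<phi> B = map_mat \<phi> B"

definition field_automorphism :: "('a::field \<Rightarrow> 'a) \<Rightarrow> bool" where
  "field_automorphism \<tau> \<longleftrightarrow> bij \<tau> \<and> (\<forall>x y. \<tau> (x + y) = \<tau> x + \<tau> y)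
      \<and> (\<forall>x y. \<tau> (x * y) = \<tau> x * \<tau> y)"

end

theory Submission
  imports Defs "Jordan_Normal_Form.Determinant"
begin

text \<open>Writing a 2 x 2 block matrix with rows (X, Y) and (Z, W), being quadratic is a system of four
  equations. Triangular instances force the map to fix 0, make the image of 1 scalar, and (after rescaling)
  make the map preserve idempotents and the relations EY = Y, EY = 0, YE = 0.
  The images of the diagonal matrix units can then be diagonalized simultaneously.

  The key instance is (-EZ, E; Z, ZE + s) for an idempotent E with EZE = tE and s = -t - 1: it is
  quadratic, and three of its blocks depend only on EZ and ZE, so these two products
  determine the corresponding products of the images. Applied to the matrix units E_ii and to the
  idempotents E_ii - E_ik this shows that the map acts entrywise, by multiples of one
  additive function. An image of a rank one idempotent shows that this function preserves squares,
  so it is a field automorphism, and the multiples form a coboundary.\<close>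

section \<open>Quadratic matrices\<close>

text \<open>The map is not assumed additive, so only quadratic identities can be transported, and
  each image satisfies them with its own unknown trace and determinant parameters. Tests are chosen
  so that these can be recovered, by means of a block 0 or 1 or an idempotent other than 0 and 1.
  For E of rank one, EZE is a multiple of E for every Z, so the key instance then applies to every
  Z. Matrix units alone show only that an off-diagonal entry (i, j) of the image depends on the
  entries (i, j) and (j, i) of the argument. The idempotents E_ii - E_ik treat rows and columns
  differently; with a third index k, where \<open>n \<ge> 3\<close> is decisive, they remove the
  entry (j, i). The one-sided relation EY = Y excludes the transposed form of the map. Conclusions
  for the other side come from transposing argument and value, which gives a preserver
  again.\<close>

lemmas square_mat_simps =
  assoc_mult_mat[of _ m m _ m _ m] mult_add_distrib_mat[of _ m m _ m] add_mult_distrib_mat[of _ m m _ _ m]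
  mult_minus_distrib_mat[of _ m m _ m] minus_mult_distrib_mat[of _ m m _ _ m]
  mult_smult_distrib[of _ m m _ m] mult_smult_assoc_mat[of _ m m _ m] for m

text \<open>Multiplying out leaves an identity in the sum and the product of \<open>a\<close> and
  \<open>b\<close>. Without subtraction it can be compared entry by entry and block by
  block.\<close>

lemma quadratic_mat_iff:
  fixes T :: "'a::comm_ring_1 mat"
  assumes T: "T \<in> carrier_mat m m"
  shows "quadratic_mat T \<longleftrightarrow> (\<exists>a b. T * T + (a * b) \<cdot>\<^sub>m 1\<^sub>m m = (a + b) \<cdot>\<^sub>m T)"
proof -
  have "(T - a \<cdot>\<^sub>m 1\<^sub>m m) * (T - b \<cdot>\<^sub>m 1\<^sub>m m) = T * T - (a + b) \<cdot>\<^sub>m T + (a * b) \<cdot>\<^sub>m 1\<^sub>m m" for a b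
  proof -
    have "(T - a \<cdot>\<^sub>m 1\<^sub>m m) * (T - b \<cdot>\<^sub>m 1\<^sub>m m)
        = T * T - a \<cdot>\<^sub>m T - b \<cdot>\<^sub>m (T - a \<cdot>\<^sub>m 1\<^sub>m m)"
      using T by (simp add: square_mat_simps[where m=m] minus_carrier_mat)
    also have "\<dots> = T * T - (a + b) \<cdot>\<^sub>m T + (a * b) \<cdot>\<^sub>m 1\<^sub>m m"
      using T by (intro eq_matI) (auto simp: algebra_simps simp del: index_mult_mat(1))
    finally show ?thesis .
  qed
  moreover have "T * T - (a + b) \<cdot>\<^sub>m T + (a * b) \<cdot>\<^sub>m 1\<^sub>m m = 0\<^sub>m m m \<longleftrightarrow>
      T * T + (a * b) \<cdot>\<^sub>m 1\<^sub>m m = (a + b) \<cdot>\<^sub>m T" for a b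
    using T by (auto simp: mat_eq_iff algebra_simps simp del: index_mult_mat(1))
  ultimately show ?thesis
    using T by (simp add: quadratic_mat_def)
qed

lemma quadratic_mat_similar:
  fixes T :: "'a::comm_ring_1 mat"
  assumes T: "T \<in> carrier_mat m m" and A: "A \<in> carrier_mat m m" and B: "B \<in> carrier_mat m m"
    and AB: "A * B = 1\<^sub>m m" and BA: "B * A = 1\<^sub>m m"
    and q: "quadratic_mat T"
  shows "quadratic_mat (c \<cdot>\<^sub>m (A * T * B))"
proof -
  obtain a b where *: "T * T + (a * b) \<cdot>\<^sub>m 1\<^sub>m m = (a + b) \<cdot>\<^sub>m T"
    using q quadratic_mat_iff[OF T] by auto
  define S where "S = A * T * B"
  have S: "S \<in> carrier_mat m m" using assms by (simp add: S_def)
  have "S * S = A * T * (B * (A * (T * B)))"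
    using T A B by (simp add: S_def assoc_mult_mat[of _ m m _ m _ m])
  also have "B * (A * (T * B)) = T * B"
  proof -
    have "B * (A * (T * B)) = (B * A) * (T * B)"
      using T A B by (simp add: square_mat_simps[where m=m])
    then show ?thesis using T B by (simp add: BA)
  qed
  finally have SS: "S * S = A * (T * T) * B"
    using T A B by (simp add: square_mat_simps[where m=m])
  have "A * (T * T + (a * b) \<cdot>\<^sub>m 1\<^sub>m m) * B = S * S + (a * b) \<cdot>\<^sub>m 1\<^sub>m m"
    using T A B AB
    by (simp add: SS square_mat_simps[where m=m])
  moreover have "A * ((a + b) \<cdot>\<^sub>m T) * B = (a + b) \<cdot>\<^sub>m S"
    using T A B by (simp add: S_def square_mat_simps[where m=m])
  ultimately have eq: "S * S + (a * b) \<cdot>\<^sub>m 1\<^sub>m m = (a + b) \<cdot>\<^sub>m S" by (simp add: *)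
  \<comment> \<open>Scaling by \<open>c\<close> scales both roots, so the new parameters are
    \<open>c * a\<close> and \<open>c * b\<close>.\<close>
  have "(c \<cdot>\<^sub>m S) * (c \<cdot>\<^sub>m S) + (c * a * (c * b)) \<cdot>\<^sub>m 1\<^sub>m m
      = (c * c) \<cdot>\<^sub>m (S * S + (a * b) \<cdot>\<^sub>m 1\<^sub>m m)"
    using S by (intro eq_matI)
      (auto simp: square_mat_simps[where m=m] algebra_simps simp del: index_mult_mat(1))
  also have "\<dots> = (c * a + c * b) \<cdot>\<^sub>m (c \<cdot>\<^sub>m S)"
    unfolding eq using S by (intro eq_matI) (auto simp: algebra_simps)
  finally show ?thesis
    using S quadratic_mat_iff[of "c \<cdot>\<^sub>m S" m] by (auto simp: S_def)
qed

lemma quadratic_mat_similar_iff: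
  fixes T :: "'a::field mat"
  assumes T: "T \<in> carrier_mat m m" and A: "A \<in> carrier_mat m m" and B: "B \<in> carrier_mat m m"
    and AB: "A * B = 1\<^sub>m m" and BA: "B * A = 1\<^sub>m m" and c: "c \<noteq> 0"
  shows "quadratic_mat (c \<cdot>\<^sub>m (A * T * B)) \<longleftrightarrow> quadratic_mat T"
proof
  \<comment> \<open>The reverse direction is the forward one for the inverse conjugation and the
    factor \<open>1 / c\<close>.\<close>
  have "B * (c \<cdot>\<^sub>m (A * T * B)) * A = c \<cdot>\<^sub>m (B * A * T * (B * A))"
    using T A B
    by (simp add: square_mat_simps[where m=m])
  also have "\<dots> = c \<cdot>\<^sub>m T" using T by (simp add: BA)
  finally have "(1 / c) \<cdot>\<^sub>m (B * (c \<cdot>\<^sub>m (A * T * B)) * A) = T"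
    using c T by (intro eq_matI) auto
  then show "quadratic_mat (c \<cdot>\<^sub>m (A * T * B)) \<Longrightarrow> quadratic_mat T"
    using quadratic_mat_similar[of "c \<cdot>\<^sub>m (A * T * B)" m B A "1 / c"] assms by simp
qed (use assms quadratic_mat_similar in blast)

section \<open>Field automorphisms applied entrywise\<close>

lemma field_automorphism_simps:
  assumes "field_automorphism \<tau>"
  shows "\<tau> (x + y) = \<tau> x + \<tau> y" "\<tau> (x * y) = \<tau> x * \<tau> y" "\<tau> 0 = 0" "\<tau> 1 = 1"
    "inj \<tau>" "surj \<tau>"
proof -
  show *: "\<tau> (x + y) = \<tau> x + \<tau> y" "\<tau> (x * y) = \<tau> x * \<tau> y" "inj \<tau>" "surj \<tau>" for x y
    using assms by (auto simp: field_automorphism_def bij_def)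
  show 0: "\<tau> 0 = 0" using *(1)[of 0 0] by (metis add_cancel_right_right)
  have "\<tau> 1 \<noteq> 0" using 0 *(3) by (metis injD zero_neq_one)
  then show "\<tau> 1 = 1" using *(2)[of 1 1] by simp
qed

lemma map_mat_mult_automorphism:
  assumes "field_automorphism \<tau>" "A \<in> carrier_mat p q" "B \<in> carrier_mat q r"
  shows "map_mat \<tau> (A * B) = map_mat \<tau> A * map_mat \<tau> B"
proof -
  note [simp] = field_automorphism_simps[OF assms(1)]
  have "\<tau> (sum f S) = (\<Sum>i\<in>S. \<tau> (f i))" for f and S :: "nat set"
    by (induction S rule: infinite_finite_induct) auto
  then show ?thesis
    using assms by (intro eq_matI) (auto simp: scalar_prod_def)
qed

lemma quadratic_mat_map_iff:
  assumes \<tau>: "field_automorphism \<tau>" and T: "T \<in> carrier_mat m m"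
  shows "quadratic_mat (map_mat \<tau> T) \<longleftrightarrow> quadratic_mat T"
proof -
  note [simp] = field_automorphism_simps[OF \<tau>]
  note inj = field_automorphism_simps(5)[OF \<tau>]
  have mapinj: "map_mat \<tau> X = map_mat \<tau> Y \<longleftrightarrow> X = Y" if "X \<in> carrier_mat m m" "Y \<in> carrier_mat m m" for X Y
    using that inj by (auto simp: mat_eq_iff inj_eq)
  have * : "map_mat \<tau> T * map_mat \<tau> T + (\<tau> a * \<tau> b) \<cdot>\<^sub>m 1\<^sub>m m = (\<tau> a + \<tau> b) \<cdot>\<^sub>m map_mat \<tau> T \<longleftrightarrow>
      T * T + (a * b) \<cdot>\<^sub>m 1\<^sub>m m = (a + b) \<cdot>\<^sub>m T" for a b
  proof -
    have * : "map_mat \<tau> T * map_mat \<tau> T + (\<tau> a * \<tau> b) \<cdot>\<^sub>m 1\<^sub>m m = map_mat \<tau> (T * T + (a * b) \<cdot>\<^sub>m 1\<^sub>m m)"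
      using T by (intro eq_matI)
        (auto simp: map_mat_mult_automorphism[OF \<tau> T T, symmetric] simp del: index_mult_mat(1))
    moreover have "(\<tau> a + \<tau> b) \<cdot>\<^sub>m map_mat \<tau> T = map_mat \<tau> ((a + b) \<cdot>\<^sub>m T)"
      using T by (intro eq_matI) auto
    ultimately show ?thesis using mapinj T by simp
  qed
  \<comment> \<open>By surjectivity of \<tau>, arbitrary parameters for the image can be written as
    \<open>\<tau> a\<close> and \<open>\<tau> b\<close>.\<close>
  have "(\<exists>a b. P a b) \<longleftrightarrow> (\<exists>a b. P (\<tau> a) (\<tau> b))" for P :: "'a \<Rightarrow> 'a \<Rightarrow> bool"
    using field_automorphism_simps(6)[OF \<tau>] by (metis surjD)
  from this[of "\<lambda>a b. map_mat \<tau> T * map_mat \<tau> T + (a * b) \<cdot>\<^sub>m 1\<^sub>m m = (a + b) \<cdot>\<^sub>m map_mat \<tau> T"]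
  show ?thesis
    using T by (simp add: quadratic_mat_iff[of _ m] * )
qed

section \<open>Block matrices\<close>

text \<open>The Kronecker product of the k x k identity with \<open>A\<close>. Conjugating by it
  conjugates each block separately, as amplification requires.\<close>

definition block_diag :: "nat \<Rightarrow> nat \<Rightarrow> 'a::zero mat \<Rightarrow> 'a mat" where
  "block_diag n k A = mat (k * n) (k * n)
     (\<lambda>(r, c). if r div n = c div n then A $$ (r mod n, c mod n) else 0)"

lemma block_diag_carrier [simp]: "block_diag n k A \<in> carrier_mat (k * n) (k * n)"
  by (simp add: block_diag_def)

lemma block_mat_carrier: "B \<in> block_carrier n k \<Longrightarrow> block_mat n B \<in> carrier_mat (k * n) (k * n)"
  by (auto simp: block_mat_def block_carrier_def)

text \<open>Splits the summation index of a block matrix product into the block number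
  \<open>q\<close> and the position \<open>j\<close> inside the block.\<close>

lemma sum_lessThan_mult:
  fixes f :: "nat \<Rightarrow> 'a::comm_monoid_add"
  shows "(\<Sum>l<k * n. f l) = (\<Sum>q<k. \<Sum>j<n. f (q * n + j))"
proof -
  have "(\<Sum>l<k * n. f l) = (\<Sum>q<k. sum f {q * n..<q * n + n})" by (simp add: sum.nat_group)
  also have "\<dots> = (\<Sum>q<k. \<Sum>j<n. f (q * n + j))"
  proof (rule sum.cong[OF refl])
    fix q
    show "sum f {q * n..<q * n + n} = (\<Sum>j<n. f (q * n + j))"
      by (rule sum.reindex_bij_witness[of _ "\<lambda>j. q * n + j" "\<lambda>l. l - q * n"]) auto
  qed
  finally show ?thesis .
qed

lemma div_less_block: "r < k * n \<Longrightarrow> r div n < (k::nat)"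
  by (simp add: less_mult_imp_div_less)

lemma mod_less_block: "r < k * n \<Longrightarrow> r mod n < (n::nat)"
  by (cases n) auto

lemma block_diag_mult_left:
  fixes A :: "'a::comm_ring_1 mat"
  assumes A: "A \<in> carrier_mat n n" and T: "T \<in> block_carrier n k"
  shows "block_diag n k A * block_mat n T = block_mat n (map_mat (\<lambda>X. A * X) T)"
proof (rule eq_matI)
  have Tk: "T \<in> carrier_mat k k" and Tn: "\<And>i j. i < k \<Longrightarrow> j < k \<Longrightarrow> T $$ (i, j) \<in> carrier_mat n n"
    using T by (auto simp: block_carrier_def)
  fix r c assume "r < dim_row (block_mat n (map_mat (\<lambda>X. A * X) T))"
    "c < dim_col (block_mat n (map_mat (\<lambda>X. A * X) T))"
  then have r: "r < k * n" and c: "c < k * n" using Tk by (auto simp: block_mat_def)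
  note rc = div_less_block[OF r] div_less_block[OF c] mod_less_block[OF r] mod_less_block[OF c]
  have "(block_diag n k A * block_mat n T) $$ (r, c) =
      (\<Sum>l<k * n. block_diag n k A $$ (r, l) * block_mat n T $$ (l, c))"
    using r c Tk by (simp add: scalar_prod_def block_diag_def block_mat_def lessThan_atLeast0)
  also have "\<dots> = (\<Sum>q<k. \<Sum>j<n. block_diag n k A $$ (r, q * n + j) * block_mat n T $$ (q * n + j, c))"
    by (rule sum_lessThan_mult)
  also have "\<dots> = (\<Sum>q<k. if q = r div n then (A * T $$ (q, c div n)) $$ (r mod n, c mod n) else 0)"
  proof (rule sum.cong[OF refl])
    fix q assume "q \<in> {..<k}"
    then have q: "q < k" by simp
    have "block_diag n k A $$ (r, q * n + j) * block_mat n T $$ (q * n + j, c) =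
       (if q = r div n then A $$ (r mod n, j) * T $$ (q, c div n) $$ (j, c mod n) else 0)" if j: "j < n" for j
    proof -
      have "q * n + j < k * n"
      proof -
        have "q * n + j < Suc q * n" using j by simp
        also have "\<dots> \<le> k * n" using q by (intro mult_le_mono1) simp
        finally show ?thesis .
      qed
      then show ?thesis using q j r c Tk by (auto simp: block_diag_def block_mat_def)
    qed
    then have "(\<Sum>j<n. block_diag n k A $$ (r, q * n + j) * block_mat n T $$ (q * n + j, c)) =
      (\<Sum>j<n. if q = r div n then A $$ (r mod n, j) * T $$ (q, c div n) $$ (j, c mod n) else 0)"
      by (intro sum.cong) auto
    also have "\<dots> = (if q = r div n then (A * T $$ (q, c div n)) $$ (r mod n, c mod n) else 0)"
      using A Tn[OF q rc(2)] rc by (auto simp: scalar_prod_def lessThan_atLeast0)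
    finally show "(\<Sum>j<n. block_diag n k A $$ (r, q * n + j) * block_mat n T $$ (q * n + j, c)) = \<dots>" .
  qed
  also have "\<dots> = block_mat n (map_mat (\<lambda>X. A * X) T) $$ (r, c)"
    using rc r c Tk by (simp add: block_mat_def)
  finally show "(block_diag n k A * block_mat n T) $$ (r, c) = block_mat n (map_mat (\<lambda>X. A * X) T) $$ (r, c)" .
qed (use T in \<open>auto simp: block_mat_def block_diag_def block_carrier_def\<close>)

text \<open>Reduced to \<open>block_diag_mult_left\<close> by transposition; \<open>T'\<close> is
  the transposed array of transposed blocks.\<close>

lemma block_diag_mult_right:
  fixes A :: "'a::comm_ring_1 mat"
  assumes A: "A \<in> carrier_mat n n" and T: "T \<in> block_carrier n k"
  shows "block_mat n T * block_diag n k A = block_mat n (map_mat (\<lambda>X. X * A) T)"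
proof -
  define T' where "T' = map_mat transpose_mat (transpose_mat T)"
  have Tk: "T \<in> carrier_mat k k" and Tn: "\<And>i j. i < k \<Longrightarrow> j < k \<Longrightarrow> T $$ (i, j) \<in> carrier_mat n n"
    using T by (auto simp: block_carrier_def)
  have T': "T' \<in> block_carrier n k"
    using Tk Tn by (auto simp: block_carrier_def T'_def)
  have tr: "transpose_mat (block_mat n T) = block_mat n T'"
  proof (intro eq_matI)
    fix r c assume "r < dim_row (block_mat n T')" "c < dim_col (block_mat n T')"
    then have r: "r < k * n" and c: "c < k * n" using Tk by (auto simp: block_mat_def T'_def)
    note rc = div_less_block[OF r] div_less_block[OF c] mod_less_block[OF r] mod_less_block[OF c]
    show "transpose_mat (block_mat n T) $$ (r, c) = block_mat n T' $$ (r, c)"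
      using r c rc Tk Tn[OF rc(2,1)] by (simp add: block_mat_def T'_def)
  qed (use Tk in \<open>auto simp: block_mat_def T'_def\<close>)
  have trA: "transpose_mat (block_diag n k A) = block_diag n k (transpose_mat A)"
    using A by (intro eq_matI) (auto simp: block_diag_def mod_less_block)
  have "transpose_mat (block_mat n T * block_diag n k A) = block_diag n k (transpose_mat A) * block_mat n T'"
    using block_mat_carrier[OF T] by (simp add: transpose_mult[of _ "k * n" "k * n" _ "k * n"] tr trA)
  also have "\<dots> = block_mat n (map_mat (\<lambda>X. transpose_mat A * X) T')"
    using A T' by (simp add: block_diag_mult_left)
  also have "\<dots> = transpose_mat (block_mat n (map_mat (\<lambda>X. X * A) T))"
  proof (intro eq_matI)
    fix r c assume "r < dim_row (transpose_mat (block_mat n (map_mat (\<lambda>X. X * A) T)))"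
      "c < dim_col (transpose_mat (block_mat n (map_mat (\<lambda>X. X * A) T)))"
    then have r: "r < k * n" and c: "c < k * n" using Tk by (auto simp: block_mat_def)
    note rc = div_less_block[OF r] div_less_block[OF c] mod_less_block[OF r] mod_less_block[OF c]
    let ?X = "T $$ (c div n, r div n)"
    have "block_mat n (map_mat (\<lambda>X. transpose_mat A * X) T') $$ (r, c) =
        (transpose_mat A * transpose_mat ?X) $$ (r mod n, c mod n)"
      using r c rc(1,2) Tk by (simp add: block_mat_def T'_def del: index_mult_mat(1))
    also have "\<dots> = (?X * A) $$ (c mod n, r mod n)"
      using A Tn[OF rc(2,1)] rc(3,4)
      by (simp add: transpose_mult[of _ n n _ n, symmetric] del: index_mult_mat(1))
    also have "\<dots> = transpose_mat (block_mat n (map_mat (\<lambda>X. X * A) T)) $$ (r, c)"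
      using r c rc(1,2) Tk by (simp add: block_mat_def del: index_mult_mat(1))
    finally show "block_mat n (map_mat (\<lambda>X. transpose_mat A * X) T') $$ (r, c) =
        transpose_mat (block_mat n (map_mat (\<lambda>X. X * A) T)) $$ (r, c)" .
  qed (use Tk in \<open>auto simp: block_mat_def T'_def\<close>)
  finally show ?thesis by (metis transpose_transpose)
qed

lemma block_diag_one: "block_diag n k (1\<^sub>m n) = (1\<^sub>m (k * n) :: 'a::comm_ring_1 mat)"
proof (rule eq_matI)
  fix r c assume "r < dim_row (1\<^sub>m (k * n) :: 'a mat)" "c < dim_col (1\<^sub>m (k * n) :: 'a mat)"
  then have r: "r < k * n" and c: "c < k * n" by auto
  have "r = c \<longleftrightarrow> r div n = c div n \<and> r mod n = c mod n" by (metis div_mult_mod_eq)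
  then show "block_diag n k (1\<^sub>m n) $$ (r, c) = (1\<^sub>m (k * n) :: 'a mat) $$ (r, c)"
    using r c by (auto simp: block_diag_def mod_less_block)
qed (auto simp: block_diag_def)

lemma block_diag_mult:
  fixes A :: "'a::comm_ring_1 mat"
  assumes A: "A \<in> carrier_mat n n" and B: "B \<in> carrier_mat n n"
  shows "block_diag n k A * block_diag n k B = block_diag n k (A * B)"
proof -
  have *: "block_diag n k X = block_mat n (mat k k (\<lambda>(i, j). if i = j then X else 0\<^sub>m n n))"
    if "X \<in> carrier_mat n n" for X :: "'a mat"
    by (intro eq_matI) (auto simp: block_diag_def block_mat_def div_less_block mod_less_block)
  have "block_diag n k A * block_diag n k B =
     block_mat n (map_mat (\<lambda>X. A * X) (mat k k (\<lambda>(i, j). if i = j then B else 0\<^sub>m n n)))"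
    using A B by (subst *[OF B], subst block_diag_mult_left) (auto simp: block_carrier_def)
  also have "map_mat (\<lambda>X. A * X) (mat k k (\<lambda>(i, j). if i = j then B else 0\<^sub>m n n)) =
      mat k k (\<lambda>(i, j). if i = j then A * B else 0\<^sub>m n n)"
    using A by (intro eq_matI) auto
  finally show ?thesis using *[of "A * B"] A B by simp
qed

section \<open>Semilinear conjugations and quadratic block matrices\<close>

definition semilinear_conjugation :: "nat \<Rightarrow> ('a::field mat \<Rightarrow> 'a mat) \<Rightarrow> bool" where
  "semilinear_conjugation n \<phi> \<longleftrightarrow> (\<exists>A\<in>carrier_mat n n. \<exists>B\<in>carrier_mat n n. \<exists>c \<tau>.
            A * B = 1\<^sub>m n \<and> B * A = 1\<^sub>m n \<and> field_automorphism \<tau> \<and>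
            (\<forall>T\<in>carrier_mat n n. \<phi> T = c \<cdot>\<^sub>m (A * map_mat \<tau> T * B)))"

text \<open>The amplification applies \<tau> to all entries, conjugates by
  \<open>block_diag n k A\<close> and scales by \<open>c\<close>. Each operation respects quadratic
  matrices in both directions; injectivity serves to exclude \<open>c = 0\<close>.\<close>

lemma semilinear_conjugation_quadratic_iff:
  assumes n: "n > 0" and std: "semilinear_conjugation n \<phi>"
    and inj: "inj_on \<phi> (carrier_mat n n)" and T: "T \<in> block_carrier n k"
  shows "quadratic_mat (block_mat n T) \<longleftrightarrow> quadratic_mat (block_mat n (ampl \<phi> T))"
proof -
  obtain A B c \<tau> where A: "A \<in> carrier_mat n n" and B: "B \<in> carrier_mat n n"
    and AB: "A * B = 1\<^sub>m n" "B * A = 1\<^sub>m n" and \<tau>: "field_automorphism \<tau>"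
    and \<phi>: "\<And>T. T \<in> carrier_mat n n \<Longrightarrow> \<phi> T = c \<cdot>\<^sub>m (A * map_mat \<tau> T * B)"
    using std by (auto simp: semilinear_conjugation_def)
  have c: "c \<noteq> 0"
  proof
    assume "c = 0"
    then have "\<phi> (0\<^sub>m n n) = \<phi> (1\<^sub>m n)"
      using A B by (simp add: \<phi>) (intro eq_matI, auto)
    then have "0\<^sub>m n n = (1\<^sub>m n :: 'a mat)"
      using inj by (auto dest: inj_onD)
    then show False using n by (auto simp: mat_eq_iff split: if_splits dest: spec[of _ 0])
  qed
  have Tk: "T \<in> carrier_mat k k" and Tn: "\<And>i j. i < k \<Longrightarrow> j < k \<Longrightarrow> T $$ (i, j) \<in> carrier_mat n n"
    using T by (auto simp: block_carrier_def)
  define T\<tau> where "T\<tau> = map_mat (map_mat \<tau>) T"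
  have T\<tau>: "T\<tau> \<in> block_carrier n k" using Tk Tn by (auto simp: T\<tau>_def block_carrier_def)
  have AT: "map_mat (\<lambda>X. A * X) T\<tau> \<in> block_carrier n k"
    using T\<tau> A by (auto simp: block_carrier_def)
  have "block_mat n (ampl \<phi> T) = c \<cdot>\<^sub>m block_mat n (map_mat (\<lambda>X. X * B) (map_mat (\<lambda>X. A * X) T\<tau>))"
  proof (rule eq_matI)
    fix r s assume "r < dim_row (c \<cdot>\<^sub>m block_mat n (map_mat (\<lambda>X. X * B) (map_mat (\<lambda>X. A * X) T\<tau>)))"
      "s < dim_col (c \<cdot>\<^sub>m block_mat n (map_mat (\<lambda>X. X * B) (map_mat (\<lambda>X. A * X) T\<tau>)))"
    then have r: "r < k * n" and s: "s < k * n" using Tk by (auto simp: block_mat_def T\<tau>_def)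
    note rs = div_less_block[OF r] div_less_block[OF s] mod_less_block[OF r] mod_less_block[OF s]
    show "block_mat n (ampl \<phi> T) $$ (r, s) =
      (c \<cdot>\<^sub>m block_mat n (map_mat (\<lambda>X. X * B) (map_mat (\<lambda>X. A * X) T\<tau>))) $$ (r, s)"
      using r s rs Tk A B Tn[OF rs(1,2)]
      by (simp add: block_mat_def ampl_def T\<tau>_def \<phi> del: index_mult_mat(1) assoc_mult_mat)
  qed (use Tk in \<open>auto simp: block_mat_def ampl_def T\<tau>_def\<close>)
  also have "\<dots> = c \<cdot>\<^sub>m (block_diag n k A * block_mat n T\<tau> * block_diag n k B)"
    using A B T\<tau> AT by (simp add: block_diag_mult_left block_diag_mult_right)
  also have "block_mat n T\<tau> = map_mat \<tau> (block_mat n T)"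
    using Tk Tn by (intro eq_matI) (auto simp: T\<tau>_def block_mat_def div_less_block mod_less_block
        carrier_matD[OF Tn])
  finally have "quadratic_mat (block_mat n (ampl \<phi> T)) \<longleftrightarrow>
      quadratic_mat (map_mat \<tau> (block_mat n T))"
    using quadratic_mat_similar_iff[of "map_mat \<tau> (block_mat n T)" "k * n" "block_diag n k A" "block_diag n k B" c]
      block_mat_carrier[OF T] c A B AB by (simp add: block_diag_mult block_diag_one)
  then show ?thesis using quadratic_mat_map_iff[OF \<tau> block_mat_carrier[OF T]] by simp
qed

section \<open>Two by two blocks\<close>

definition quad :: "nat \<Rightarrow> 'a::comm_ring_1 mat \<Rightarrow> 'a mat \<Rightarrow> 'a mat \<Rightarrow> 'a mat \<Rightarrow> bool" where
  "quad n X Y Z W \<longleftrightarrow> (\<exists>a b.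
     X * X + Y * Z + (a * b) \<cdot>\<^sub>m 1\<^sub>m n = (a + b) \<cdot>\<^sub>m X \<and> X * Y + Y * W = (a + b) \<cdot>\<^sub>m Y \<and>
     Z * X + W * Z = (a + b) \<cdot>\<^sub>m Z \<and> Z * Y + W * W + (a * b) \<cdot>\<^sub>m 1\<^sub>m n = (a + b) \<cdot>\<^sub>m W)"

definition blocks :: "'a mat \<Rightarrow> 'a mat \<Rightarrow> 'a mat \<Rightarrow> 'a mat \<Rightarrow> 'a mat mat" where
  "blocks X Y Z W = mat 2 2 (\<lambda>(i, j). if i = 0 then if j = 0 then X else Y else if j = 0 then Z else W)"

lemma blocks_carrier:
  assumes "X \<in> carrier_mat n n" "Y \<in> carrier_mat n n" "Z \<in> carrier_mat n n" "W \<in> carrier_mat n n"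
  shows "blocks X Y Z W \<in> block_carrier n 2"
  using assms by (auto simp: blocks_def block_carrier_def)

lemma ampl_blocks: "ampl \<phi> (blocks X Y Z W) = blocks (\<phi> X) (\<phi> Y) (\<phi> Z) (\<phi> W)"
  by (intro eq_matI) (auto simp: ampl_def blocks_def)

lemma block_mat_blocks:
  assumes "X \<in> carrier_mat n n" "Y \<in> carrier_mat n n" "Z \<in> carrier_mat n n" "W \<in> carrier_mat n n"
  shows "block_mat n (blocks X Y Z W) = four_block_mat X Y Z W"
proof (rule eq_matI)
  fix r c assume "r < dim_row (four_block_mat X Y Z W)" "c < dim_col (four_block_mat X Y Z W)"
  then have rc: "r < 2 * n" "c < 2 * n" using assms by auto
  have div: "k div n = (if k < n then 0 else 1)" and mod: "k mod n = (if k < n then k else k - n)"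
    if "k < 2 * n" for k
    using that by (auto simp: le_div_geq le_mod_geq)
  show "block_mat n (blocks X Y Z W) $$ (r, c) = four_block_mat X Y Z W $$ (r, c)"
    using assms rc by (auto simp: block_mat_def blocks_def div mod)
qed (use assms in \<open>auto simp: block_mat_def blocks_def\<close>)

lemma four_block_mat_inject:
  assumes "A \<in> carrier_mat n n" "B \<in> carrier_mat n n" "C \<in> carrier_mat n n" "D \<in> carrier_mat n n"
    and "A' \<in> carrier_mat n n" "B' \<in> carrier_mat n n" "C' \<in> carrier_mat n n" "D' \<in> carrier_mat n n"
    and eq: "four_block_mat A B C D = four_block_mat A' B' C' D'"
  shows "A = A' \<and> B = B' \<and> C = C' \<and> D = D'"
proof -
  have eq': "four_block_mat A B C D $$ (r, c) = four_block_mat A' B' C' D' $$ (r, c)" for r c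
    by (simp only: eq)
  have "A $$ (i, j) = A' $$ (i, j)" "B $$ (i, j) = B' $$ (i, j)"
    "C $$ (i, j) = C' $$ (i, j)" "D $$ (i, j) = D' $$ (i, j)" if "i < n" "j < n" for i j
    using that assms(1-8) eq'[of i j] eq'[of i "n + j"] eq'[of "n + i" j] eq'[of "n + i" "n + j"]
    by auto
  then show ?thesis using assms(1-8) by (auto intro!: eq_matI)
qed

lemma quadratic_blocks_iff:
  fixes X :: "'a::comm_ring_1 mat"
  assumes C: "X \<in> carrier_mat n n" "Y \<in> carrier_mat n n" "Z \<in> carrier_mat n n" "W \<in> carrier_mat n n"
  shows "quadratic_mat (block_mat n (blocks X Y Z W)) \<longleftrightarrow> quad n X Y Z W"
proof -
  let ?M = "four_block_mat X Y Z W"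
  have M: "?M \<in> carrier_mat (n + n) (n + n)" using C by simp
  have MM: "?M * ?M = four_block_mat (X * X + Y * Z) (X * Y + Y * W) (Z * X + W * Z) (Z * Y + W * W)"
    using C by (intro mult_four_block_mat) auto
  have "?M * ?M + (a * b) \<cdot>\<^sub>m 1\<^sub>m (n + n) = (a + b) \<cdot>\<^sub>m ?M \<longleftrightarrow>
     X * X + Y * Z + (a * b) \<cdot>\<^sub>m 1\<^sub>m n = (a + b) \<cdot>\<^sub>m X \<and> X * Y + Y * W = (a + b) \<cdot>\<^sub>m Y \<and>
     Z * X + W * Z = (a + b) \<cdot>\<^sub>m Z \<and> Z * Y + W * W + (a * b) \<cdot>\<^sub>m 1\<^sub>m n = (a + b) \<cdot>\<^sub>m W" for a b
  proof -
    have "(a * b) \<cdot>\<^sub>m 1\<^sub>m (n + n) =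
        four_block_mat ((a * b) \<cdot>\<^sub>m 1\<^sub>m n) (0\<^sub>m n n) (0\<^sub>m n n) ((a * b) \<cdot>\<^sub>m 1\<^sub>m n)"
      by (intro eq_matI) auto
    then have "?M * ?M + (a * b) \<cdot>\<^sub>m 1\<^sub>m (n + n) = four_block_mat (X * X + Y * Z + (a * b) \<cdot>\<^sub>m 1\<^sub>m n)
        (X * Y + Y * W) (Z * X + W * Z) (Z * Y + W * W + (a * b) \<cdot>\<^sub>m 1\<^sub>m n)"
      using C by (subst MM) (simp add: add_four_block_mat[of _ n n _ n _ n])
    moreover have "(a + b) \<cdot>\<^sub>m ?M = four_block_mat ((a + b) \<cdot>\<^sub>m X) ((a + b) \<cdot>\<^sub>m Y) ((a + b) \<cdot>\<^sub>m Z) ((a + b) \<cdot>\<^sub>m W)"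
      using C by (simp add: smult_four_block_mat[of _ n n _ n _ n])
    ultimately show ?thesis
      using C four_block_mat_inject[of "X * X + Y * Z + (a * b) \<cdot>\<^sub>m 1\<^sub>m n" n "X * Y + Y * W" "Z * X + W * Z"
        "Z * Y + W * W + (a * b) \<cdot>\<^sub>m 1\<^sub>m n" "(a + b) \<cdot>\<^sub>m X" "(a + b) \<cdot>\<^sub>m Y" "(a + b) \<cdot>\<^sub>m Z" "(a + b) \<cdot>\<^sub>m W"] by auto
  qed
  then show ?thesis
    by (simp add: block_mat_blocks[OF C] quadratic_mat_iff[OF M] quad_def)
qed

lemma zero_smult_mat [simp]: "(0::'a::mult_zero) \<cdot>\<^sub>m A = 0\<^sub>m (dim_row A) (dim_col A)"
  by (intro eq_matI) auto

lemma one_smult_mat [simp]: "(1::'a::monoid_mult) \<cdot>\<^sub>m A = A"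
  by (intro eq_matI) auto

text \<open>The case of determinant parameter \<open>a * b = 0\<close>, which suffices for every test matrix below.\<close>

lemma quadI:
  fixes X :: "'a::comm_ring_1 mat"
  assumes "X \<in> carrier_mat n n" "Y \<in> carrier_mat n n" "Z \<in> carrier_mat n n" "W \<in> carrier_mat n n"
    and "X * X + Y * Z = s \<cdot>\<^sub>m X" "X * Y + Y * W = s \<cdot>\<^sub>m Y" "Z * X + W * Z = s \<cdot>\<^sub>m Z" "Z * Y + W * W = s \<cdot>\<^sub>m W"
  shows "quad n X Y Z W"
proof -
  have "A + (s * 0) \<cdot>\<^sub>m 1\<^sub>m n = A" if "A \<in> carrier_mat n n" for A
    using that by (intro eq_matI) auto
  then show ?thesis
    unfolding quad_def using assms by (intro exI[of _ s] exI[of _ 0]) simp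
qed

text \<open>Trades the roots for their product \<open>p\<close> and sum \<open>s\<close>, in which
  the equations are linear.\<close>

lemma quadE:
  assumes "quad n X Y Z W"
  obtains s p where "X * X + Y * Z + p \<cdot>\<^sub>m 1\<^sub>m n = s \<cdot>\<^sub>m X" "X * Y + Y * W = s \<cdot>\<^sub>m Y"
     "Z * X + W * Z = s \<cdot>\<^sub>m Z" "Z * Y + W * W + p \<cdot>\<^sub>m 1\<^sub>m n = s \<cdot>\<^sub>m W"
  using assms by (auto simp: quad_def)

text \<open>With lower left block 0, both diagonal blocks satisfy the same polynomial, and
  \<open>Y\<close> enters only through one linear equation. A known diagonal block can thus fix
  \<open>s\<close> and \<open>p\<close> for the other.\<close>

lemma quad_triangularE:
  assumes "quad n X Y (0\<^sub>m n n) W" "X \<in> carrier_mat n n" "Y \<in> carrier_mat n n" "W \<in> carrier_mat n n"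
  obtains s p where "X * X + p \<cdot>\<^sub>m 1\<^sub>m n = s \<cdot>\<^sub>m X" "X * Y + Y * W = s \<cdot>\<^sub>m Y"
     "W * W + p \<cdot>\<^sub>m 1\<^sub>m n = s \<cdot>\<^sub>m W"
  using assms(1) by (rule quadE) (use assms(2-) that in auto)

lemma quad_transpose:
  fixes X :: "'a::comm_ring_1 mat"
  assumes C: "X \<in> carrier_mat n n" "Y \<in> carrier_mat n n" "Z \<in> carrier_mat n n" "W \<in> carrier_mat n n"
    and q: "quad n X Y Z W"
  shows "quad n (transpose_mat X) (transpose_mat Z) (transpose_mat Y) (transpose_mat W)"
proof -
  obtain a b where *: "X * X + Y * Z + (a * b) \<cdot>\<^sub>m 1\<^sub>m n = (a + b) \<cdot>\<^sub>m X" "X * Y + Y * W = (a + b) \<cdot>\<^sub>m Y"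
     "Z * X + W * Z = (a + b) \<cdot>\<^sub>m Z" "Z * Y + W * W + (a * b) \<cdot>\<^sub>m 1\<^sub>m n = (a + b) \<cdot>\<^sub>m W"
    using q by (auto simp: quad_def)
  have t: "transpose_mat (A + B) = transpose_mat A + transpose_mat B"
    "transpose_mat (A * B) = transpose_mat B * transpose_mat A"
    if "A \<in> carrier_mat n n" "B \<in> carrier_mat n n" for A B :: "'a mat"
    using that by (auto simp: transpose_add transpose_mult)
  have s: "transpose_mat (c \<cdot>\<^sub>m A) = c \<cdot>\<^sub>m transpose_mat A" if "A \<in> carrier_mat n n" for c and A :: "'a mat"
    using that by (intro eq_matI) auto
  from *[THEN arg_cong[of _ _ transpose_mat]] show ?thesis
    unfolding quad_def using C by (intro exI[of _ a] exI[of _ b]) (simp add: t s)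
qed

section \<open>Matrix units\<close>

definition mat_unit :: "nat \<Rightarrow> nat \<Rightarrow> nat \<Rightarrow> 'a::comm_ring_1 mat" where
  "mat_unit n i j = mat n n (\<lambda>(a, b). if a = i \<and> b = j then 1 else 0)"

lemma mat_unit_carrier [simp]: "mat_unit n i j \<in> carrier_mat n n"
  by (simp add: mat_unit_def)

lemma mat_unit_dim [simp]: "dim_row (mat_unit n i j) = n" "dim_col (mat_unit n i j) = n"
  by (simp_all add: mat_unit_def)

lemma mat_unit_index [simp]:
  "a < n \<Longrightarrow> b < n \<Longrightarrow> mat_unit n i j $$ (a, b) = (if a = i \<and> b = j then 1 else 0)"
  by (simp add: mat_unit_def)

lemma index_mult_sum:
  assumes "A \<in> carrier_mat n n" "B \<in> carrier_mat n n" "i < n" "j < n"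
  shows "(A * B) $$ (i, j) = (\<Sum>k<n. A $$ (i, k) * B $$ (k, j))"
  using assms by (simp add: scalar_prod_def lessThan_atLeast0)

lemma mat_unit_mult_left:
  assumes "Z \<in> carrier_mat n n" "i < n" "j < n" "a < n" "b < n"
  shows "(mat_unit n i j * Z) $$ (a, b) = (if a = i then Z $$ (j, b) else 0)"
  using assms by (cases "a = i") (simp_all add: index_mult_sum[of _ n] if_distrib[of "\<lambda>x. x * _"]
    cong: if_cong del: index_mult_mat(1))

lemma mat_unit_mult_right:
  assumes "Z \<in> carrier_mat n n" "i < n" "j < n" "a < n" "b < n"
  shows "(Z * mat_unit n i j) $$ (a, b) = (if b = j then Z $$ (a, i) else 0)"
  using assms by (cases "b = j") (simp_all add: index_mult_sum[of _ n] if_distrib[of "\<lambda>x. _ * x"]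
    cong: if_cong del: index_mult_mat(1))

text \<open>The 2 x 2 condition in block form. Characteristic 0 covers the real and complex cases
  together and permits the divisions by 2 in \<open>phi_zero\<close> and
  \<open>scalar_map_mult\<close>.\<close>

locale quad_preserver =
  fixes n :: nat and \<phi> :: "'a::field_char_0 mat \<Rightarrow> 'a mat"
  assumes n3: "n \<ge> 3"
    and bij: "bij_betw \<phi> (carrier_mat n n) (carrier_mat n n)"
    and quad_iff: "X \<in> carrier_mat n n \<Longrightarrow> Y \<in> carrier_mat n n \<Longrightarrow> Z \<in> carrier_mat n n \<Longrightarrow>
      W \<in> carrier_mat n n \<Longrightarrow> quad n (\<phi> X) (\<phi> Y) (\<phi> Z) (\<phi> W) \<longleftrightarrow> quad n X Y Z W"
begin

abbreviation "C \<equiv> (carrier_mat n n :: 'a mat set)"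
abbreviation "Null \<equiv> (0\<^sub>m n n :: 'a mat)"
abbreviation "One \<equiv> (1\<^sub>m n :: 'a mat)"

lemmas sq = square_mat_simps[where m=n]

lemma mult_closed [simp]: "X \<in> C \<Longrightarrow> Y \<in> C \<Longrightarrow> X * Y \<in> C"
  by (rule mult_carrier_mat)

lemma phi_carrier [simp]: "X \<in> C \<Longrightarrow> \<phi> X \<in> C"
  using bij by (auto simp: bij_betw_def)

lemma phi_dim [simp]: assumes "X \<in> C" shows "dim_row (\<phi> X) = n" "dim_col (\<phi> X) = n"
  using phi_carrier[OF assms] by auto

lemma phi_eq_iff: "X \<in> C \<Longrightarrow> Y \<in> C \<Longrightarrow> \<phi> X = \<phi> Y \<longleftrightarrow> X = Y"
  using bij by (auto simp: bij_betw_def inj_on_def)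

lemma phi_surj: assumes "Y \<in> C" obtains X where "X \<in> C" "\<phi> X = Y"
  using bij assms that by (metis bij_betw_imp_surj_on imageE)

lemma smult_one_eq_zero: assumes "p \<cdot>\<^sub>m One = Null" shows "p = 0"
  using arg_cong[OF assms, of "\<lambda>M. M $$ (0, 0)"] n3 by simp

text \<open>By surjectivity the upper right block of the image can be any \<open>Y\<close> while the
  other three blocks are \<open>\<phi> Null\<close>. The choice \<open>Y = One\<close> makes
  \<open>\<phi> Null\<close> scalar, and an off-diagonal matrix unit then forces that scalar to be
  0.\<close>

lemma phi_zero [simp]: "\<phi> Null = Null"
proof -
  have q: "quad n (\<phi> Null) Y (\<phi> Null) (\<phi> Null)" if "Y \<in> C" for Y
  proof -
    obtain X where X: "X \<in> C" "\<phi> X = Y" using phi_surj[OF \<open>Y \<in> C\<close>] by metis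
    have "quad n Null X Null Null" using X(1) by (intro quadI[where s=0]) simp_all
    then show ?thesis using quad_iff[of Null X Null Null] X by simp
  qed
  obtain s where "\<phi> Null * One + One * \<phi> Null = s \<cdot>\<^sub>m One" using q[of One] by (rule quadE) auto
  then have s: "\<phi> Null + \<phi> Null = s \<cdot>\<^sub>m One" by simp
  define c where "c = s / 2"
  have c: "\<phi> Null = c \<cdot>\<^sub>m One"
  proof (rule eq_matI)
    fix i j assume "i < dim_row (c \<cdot>\<^sub>m One)" "j < dim_col (c \<cdot>\<^sub>m One)"
    moreover have "(\<phi> Null + \<phi> Null) $$ (i, j) = (s \<cdot>\<^sub>m One) $$ (i, j)" by (simp only: s)
    moreover have "\<phi> Null \<in> C" by simp
    ultimately show "\<phi> Null $$ (i, j) = (c \<cdot>\<^sub>m One) $$ (i, j)"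
      by (auto simp: c_def field_simps simp flip: mult_2)
  qed (use phi_carrier[of Null] in auto)
  let ?E = "mat_unit n 0 1"
  obtain t p where "\<phi> Null * \<phi> Null + ?E * \<phi> Null + p \<cdot>\<^sub>m One = t \<cdot>\<^sub>m \<phi> Null"
    using q[of ?E] by (rule quadE) auto
  from arg_cong[OF this, of "\<lambda>M. M $$ (0, 1)"] have "c = 0"
    using n3 unfolding c by (simp add: sq)
  then show ?thesis using c by (auto intro!: eq_matI)
qed

lemma phi_eq_zero_iff: "X \<in> C \<Longrightarrow> \<phi> X = Null \<longleftrightarrow> X = Null"
  using phi_eq_iff[of X Null] by simp

lemma phi_one_scalar: "\<exists>c. c \<noteq> 0 \<and> \<phi> One = c \<cdot>\<^sub>m One"
proof -
  \<comment> \<open>With a preimage of 1 as upper right block, the (1,2) equation of the image says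
    directly that \<open>\<phi> One\<close> is scalar.\<close>
  obtain X where X: "X \<in> C" "\<phi> X = One" by (rule phi_surj[of One]) auto
  have "quad n One X Null Null" using X(1) by (intro quadI[where s=1]) simp_all
  then have "quad n (\<phi> One) One Null Null" using quad_iff[of One X Null Null] X by simp
  then obtain s where s: "\<phi> One * One + One * Null = s \<cdot>\<^sub>m One" by (rule quad_triangularE) auto
  have "\<phi> One \<in> C" by simp
  then have *: "\<phi> One = s \<cdot>\<^sub>m One" using s by simp
  moreover have "\<phi> One \<noteq> Null"
    using phi_eq_zero_iff[of One] smult_one_eq_zero[of 1] by (auto intro!: eq_matI)
  ultimately show ?thesis by (auto intro!: eq_matI)
qed

lemma transpose: "quad_preserver n (\<lambda>X. transpose_mat (\<phi> (transpose_mat X)))"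
proof
  have "bij_betw transpose_mat C C"
    by (rule bij_betwI[of _ _ _ transpose_mat]) auto
  from bij_betw_trans[OF bij_betw_trans[OF this bij] this]
  show "bij_betw (\<lambda>X. transpose_mat (\<phi> (transpose_mat X))) C C" by (simp add: comp_def)
  fix X Y Z W assume *: "X \<in> C" "Y \<in> C" "Z \<in> C" "W \<in> C"
  have tr: "quad n (transpose_mat X) (transpose_mat Z) (transpose_mat Y) (transpose_mat W) \<longleftrightarrow> quad n X Y Z W"
    if "X \<in> C" "Y \<in> C" "Z \<in> C" "W \<in> C" for X Y Z W
    using that quad_transpose[of X n Y Z W]
      quad_transpose[of "transpose_mat X" n "transpose_mat Z" "transpose_mat Y" "transpose_mat W"] by auto
  show "quad n (transpose_mat (\<phi> (transpose_mat X))) (transpose_mat (\<phi> (transpose_mat Y)))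
     (transpose_mat (\<phi> (transpose_mat Z))) (transpose_mat (\<phi> (transpose_mat W))) \<longleftrightarrow> quad n X Y Z W"
    using * by (simp add: tr quad_iff)
qed (rule n3)

text \<open>The outer map is a semilinear conjugation with trivial automorphism, so its invariance
  is the case of 2 x 2 blocks of \<open>semilinear_conjugation_quadratic_iff\<close>.\<close>

lemma conjugate:
  assumes A: "A \<in> C" and B: "B \<in> C" and AB: "A * B = One" "B * A = One" and c: "c \<noteq> 0"
  shows "quad_preserver n (\<lambda>X. c \<cdot>\<^sub>m (A * \<phi> X * B))"
proof -
  define t where "t X = c \<cdot>\<^sub>m (A * X * B)" for X
  have tC: "t X \<in> C" if "X \<in> C" for X using that A B by (simp add: t_def)
  have inv: "c' \<cdot>\<^sub>m (B' * (c'' \<cdot>\<^sub>m (A' * X * B')) * A') = X"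
    if "X \<in> C" "A' \<in> C" "B' \<in> C" "A' * B' = One" "B' * A' = One" "c' * c'' = 1" for X A' B' c' c''
  proof -
    have "B' * (c'' \<cdot>\<^sub>m (A' * X * B')) * A' = c'' \<cdot>\<^sub>m ((B' * A') * X * (B' * A'))"
      using that(1-3) by (simp add: sq)
    then show ?thesis using that by (auto intro!: eq_matI simp flip: mult.assoc)
  qed
  have bt: "bij_betw t C C"
  proof (rule bij_betwI[of _ _ _ "\<lambda>X. (1 / c) \<cdot>\<^sub>m (B * X * A)"])
    fix X assume X: "X \<in> C"
    show "(1 / c) \<cdot>\<^sub>m (B * t X * A) = X" using inv[OF X A B AB, of "1 / c" c] c by (simp add: t_def)
    show "t ((1 / c) \<cdot>\<^sub>m (B * X * A)) = X" using inv[OF X B A AB(2,1), of c "1 / c"] c by (simp add: t_def)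
  qed (use A B tC in auto)
  have "field_automorphism (id :: 'a \<Rightarrow> 'a)" by (simp add: field_automorphism_def)
  moreover have "map_mat id X = X" for X :: "'a mat" by (intro eq_matI) auto
  ultimately have st: "semilinear_conjugation n t"
    unfolding semilinear_conjugation_def t_def using A B AB by (metis)
  have tq: "quad n (t X) (t Y) (t Z) (t W) \<longleftrightarrow> quad n X Y Z W"
    if "X \<in> C" "Y \<in> C" "Z \<in> C" "W \<in> C" for X Y Z W
    using semilinear_conjugation_quadratic_iff[OF _ st bij_betw_imp_inj_on[OF bt] blocks_carrier[OF that]]
      n3 that tC by (simp add: quadratic_blocks_iff ampl_blocks)
  have "quad_preserver n (t \<circ> \<phi>)"
    by standard (use n3 bij_betw_trans[OF bij bt] tq quad_iff in auto)
  then show ?thesis by (simp add: comp_def t_def)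
qed

end

section \<open>Preservers fixing the identity\<close>

locale unital_quad_preserver = quad_preserver +
  assumes phi_one [simp]: "\<phi> (1\<^sub>m n) = 1\<^sub>m n"
begin

lemma mat_unit_neq_zero: assumes "i < n" shows "mat_unit n i i \<noteq> Null"
proof
  assume "mat_unit n i i = Null"
  from arg_cong[OF this, of "\<lambda>M. M $$ (i, i)"] show False using assms by simp
qed

lemma phi_eq_one_iff: "X \<in> C \<Longrightarrow> \<phi> X = One \<longleftrightarrow> X = One"
  using phi_eq_iff[of X One] by simp

text \<open>Affine functions that agree at two different points have the same slope. The points will
  be an entry of an idempotent and the corresponding entry of 1.\<close>

lemma affine_coincidence:
  fixes x :: "'b::idom"
  assumes "x + p * a = y + q * a" "x + p * b = y + q * b" "a \<noteq> b"
  shows "p = q"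
proof -
  have "(p - q) * (b - a) = ((x + p * b) - (y + q * b)) - ((x + p * a) - (y + q * a))"
    by (simp add: algebra_simps)
  also have "\<dots> = 0" by (simp only: assms diff_self)
  finally show ?thesis using assms(3) by simp
qed

lemma mat_neqD: assumes "A \<in> C" "B \<in> C" "A \<noteq> B"
  obtains i j where "i < n" "j < n" "A $$ (i, j) \<noteq> B $$ (i, j)"
  using assms by (auto simp: mat_eq_iff)

lemma smult_cancel:
  assumes A: "A \<in> C" "A \<noteq> Null" and eq: "s \<cdot>\<^sub>m A = t \<cdot>\<^sub>m A"
  shows "s = t"
proof -
  obtain i j where ij: "i < n" "j < n" "A $$ (i, j) \<noteq> Null $$ (i, j)"
    using mat_neqD[OF A(1) _ A(2)] by auto
  then show ?thesis using arg_cong[OF eq, of "\<lambda>M. M $$ (i, j)"] A by simp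
qed

text \<open>Uses preservation backwards: a scalar commutes with the upper right block 1, and pulling
  this test back puts \<open>E\<close> alone into the (1,2) equation.\<close>

lemma scalar_of_phi_scalar:
  assumes E: "E \<in> C" and eq: "\<phi> E = e \<cdot>\<^sub>m One"
  shows "\<exists>s. E = s \<cdot>\<^sub>m One"
proof -
  have "quad n (e \<cdot>\<^sub>m One) One Null Null"
    by (intro quadI[where s=e]) (simp_all add: sq)
  then have "quad n E One Null Null"
    using quad_iff[of E One Null Null] E eq by simp
  then obtain s where "E * One + One * Null = s \<cdot>\<^sub>m One"
    by (rule quad_triangularE) (use E in auto)
  then show ?thesis using E by auto
qed

text \<open>Two tests with lower right block 0 and 1. The first kills the determinant parameter and
  leaves only a multiple \<open>t\<close> undetermined; the second is needed to show
  \<open>t = 1\<close>.\<close>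

lemma phi_idempotent:
  assumes E: "E \<in> C" and EE: "E * E = E"
  shows "\<phi> E * \<phi> E = \<phi> E"
proof -
  let ?E = "\<phi> E"
  have C [simp]: "?E \<in> C" using E by simp
  have "quad n E Null Null Null" using E EE by (intro quadI[where s=1]) simp_all
  then have "quad n ?E Null Null Null" using quad_iff[of E Null Null Null] E by simp
  then obtain t p where 1: "?E * ?E + p \<cdot>\<^sub>m One = t \<cdot>\<^sub>m ?E" "Null * Null + p \<cdot>\<^sub>m One = t \<cdot>\<^sub>m Null"
    by (rule quad_triangularE) (use E in auto)
  then have "p = 0" using smult_one_eq_zero[of p] by simp
  with 1 have t: "?E * ?E = t \<cdot>\<^sub>m ?E" by simp
  have "quad n E Null Null One" using E EE by (intro quadI[where s=1]) simp_all
  then have "quad n ?E Null Null One" using quad_iff[of E Null Null One] E by simp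
  then obtain s q where 2: "?E * ?E + q \<cdot>\<^sub>m One = s \<cdot>\<^sub>m ?E" "One * One + q \<cdot>\<^sub>m One = s \<cdot>\<^sub>m One"
    by (rule quad_triangularE) (use E in auto)
  have q: "q = s - 1"
    using arg_cong[OF 2(2), of "\<lambda>M. M $$ (0, 0)"] n3 by (simp add: algebra_simps)
  show ?thesis
  proof (cases "s = t")
    case True
    have "q \<cdot>\<^sub>m One = Null"
    proof (rule eq_matI)
      fix i j assume "i < dim_row Null" "j < dim_col Null"
      then show "(q \<cdot>\<^sub>m One) $$ (i, j) = Null $$ (i, j)"
        using arg_cong[OF 2(1), of "\<lambda>M. M $$ (i, j)"] True E by (simp add: t)
    qed auto
    then have "q = 0" by (rule smult_one_eq_zero)
    then have "s = 1" using q by simp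
    then show ?thesis using t True by simp
  next
    case False
    \<comment> \<open>Subtracting two monic quadratic equations with different traces leaves a
      linear one, so the image is scalar. Then \<open>E\<close> is a scalar idempotent, that is 0 or
      1, and both images are known.\<close>
    have "?E = (q / (s - t)) \<cdot>\<^sub>m One"
    proof (rule eq_matI)
      fix i j assume "i < dim_row ((q / (s - t)) \<cdot>\<^sub>m One)" "j < dim_col ((q / (s - t)) \<cdot>\<^sub>m One)"
      then show "?E $$ (i, j) = ((q / (s - t)) \<cdot>\<^sub>m One) $$ (i, j)"
        using arg_cong[OF 2(1), of "\<lambda>M. M $$ (i, j)"] False E
        by (simp add: t field_simps split: if_splits)
    qed (use E in auto)
    then obtain u where u: "E = u \<cdot>\<^sub>m One" using scalar_of_phi_scalar[OF E] by blast
    have "u = 0 \<or> u = 1"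
      using arg_cong[OF EE, of "\<lambda>M. M $$ (0, 0)"] n3 by (simp add: u sq)
    then have "E = Null \<or> E = One" using u by auto
    then show ?thesis by auto
  qed
qed

text \<open>The zero lower right block forces \<open>p = 0\<close>, and idempotence of
  \<open>\<phi> E\<close> then forces \<open>s = 1\<close>. The (1,2) equation becomes the
  claim.\<close>

lemma phi_left_fix:
  assumes E: "E \<in> C" "E * E = E" and Y: "Y \<in> C" "E * Y = Y"
  shows "\<phi> E * \<phi> Y = \<phi> Y"
proof (cases "E = Null")
  case True
  then have "Y = Null" using Y by auto
  then show ?thesis using True by simp
next
  case False
  have "quad n E Y Null Null" using E Y by (intro quadI[where s=1]) simp_all
  then have "quad n (\<phi> E) (\<phi> Y) Null Null" using quad_iff[of E Y Null Null] E Y by simp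
  then obtain s p where s: "\<phi> E * \<phi> E + p \<cdot>\<^sub>m One = s \<cdot>\<^sub>m \<phi> E"
    "\<phi> E * \<phi> Y + \<phi> Y * Null = s \<cdot>\<^sub>m \<phi> Y" "Null * Null + p \<cdot>\<^sub>m One = s \<cdot>\<^sub>m Null"
    by (rule quad_triangularE) (use E Y in auto)
  then have "p = 0" using smult_one_eq_zero[of p] by simp
  then have "1 \<cdot>\<^sub>m \<phi> E = s \<cdot>\<^sub>m \<phi> E" using s(1) E phi_idempotent[OF E] by simp
  then have "1 = s" using smult_cancel[of "\<phi> E" 1 s] False E phi_eq_zero_iff[of E] by simp
  then show ?thesis using s(2) E Y by simp
qed

text \<open>Since 1 satisfies the polynomial, it is (x - 1)(x - p). On an idempotent it takes the
  value p(1 - E), so \<open>p = 0\<close> unless \<open>E\<close> is 1.\<close>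

lemma eq_one_if_affine:
  assumes E: "E \<in> C" "E * E = E" "E \<noteq> One" and eq: "E * E + p \<cdot>\<^sub>m One = s \<cdot>\<^sub>m E" "One * One + p \<cdot>\<^sub>m One = s \<cdot>\<^sub>m One"
  shows "s = 1"
proof -
  have p: "1 + p = s" using arg_cong[OF eq(2), of "\<lambda>M. M $$ (0, 0)"] n3 by simp
  obtain i j where ij: "i < n" "j < n" "E $$ (i, j) \<noteq> One $$ (i, j)"
    using mat_neqD[of E One] E by auto
  have "E $$ (i, j) + p * One $$ (i, j) = s * E $$ (i, j)"
    using arg_cong[OF eq(1), of "\<lambda>M. M $$ (i, j)"] ij E by simp
  then have "p * One $$ (i, j) = p * E $$ (i, j)" unfolding p[symmetric] by (simp add: distrib_right)
  then have "p = 0" using ij(3) by auto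
  then show ?thesis using p by simp
qed

lemma add_right_cancel_mat:
  assumes "A \<in> C" "B \<in> C" "A + B = B"
  shows "A = Null"
proof (rule eq_matI)
  fix i j assume "i < dim_row Null" "j < dim_col Null"
  then show "A $$ (i, j) = Null $$ (i, j)"
    using arg_cong[OF assms(3), of "\<lambda>M. M $$ (i, j)"] assms(1,2) by simp
qed (use assms in auto)

text \<open>A lower right block 1 adds \<open>Y\<close> to the left of the (1,2) equation, so trace
  parameter 1 now expresses annihilation rather than fixing.\<close>

lemma phi_left_annihilate:
  assumes E: "E \<in> C" "E * E = E" and Y: "Y \<in> C" "E * Y = Null"
  shows "\<phi> E * \<phi> Y = Null"
proof (cases "E = One")
  case True
  then show ?thesis using Y by simp
next
  case False
  have "quad n E Y Null One" using E Y by (intro quadI[where s=1]) simp_all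
  then have "quad n (\<phi> E) (\<phi> Y) Null One" using quad_iff[of E Y Null One] E Y by simp
  then obtain s p where s: "\<phi> E * \<phi> E + p \<cdot>\<^sub>m One = s \<cdot>\<^sub>m \<phi> E"
    "\<phi> E * \<phi> Y + \<phi> Y * One = s \<cdot>\<^sub>m \<phi> Y" "One * One + p \<cdot>\<^sub>m One = s \<cdot>\<^sub>m One"
    by (rule quad_triangularE) (use E Y in auto)
  have "s = 1"
    using eq_one_if_affine[OF _ phi_idempotent[OF E] _ s(1,3)] E False phi_eq_one_iff by simp
  then show ?thesis using s(2) E Y add_right_cancel_mat[of "\<phi> E * \<phi> Y" "\<phi> Y"] by simp
qed

lemma phi_right_annihilate:
  assumes E: "E \<in> C" "E * E = E" and Y: "Y \<in> C" "Y * E = Null"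
  shows "\<phi> Y * \<phi> E = Null"
proof (cases "E = One")
  case True
  then show ?thesis using Y by simp
next
  case False
  have "quad n One Y Null E" using E Y by (intro quadI[where s=1]) simp_all
  then have "quad n One (\<phi> Y) Null (\<phi> E)" using quad_iff[of One Y Null E] E Y by simp
  then obtain s p where s: "One * One + p \<cdot>\<^sub>m One = s \<cdot>\<^sub>m One"
    "One * \<phi> Y + \<phi> Y * \<phi> E = s \<cdot>\<^sub>m \<phi> Y" "\<phi> E * \<phi> E + p \<cdot>\<^sub>m One = s \<cdot>\<^sub>m \<phi> E"
    by (rule quad_triangularE) (use E Y in auto)
  have "s = 1"
    using eq_one_if_affine[OF _ phi_idempotent[OF E] _ s(3,1)] E False phi_eq_one_iff by simp
  then have "\<phi> Y * \<phi> E + \<phi> Y = \<phi> Y" 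
    using s(2) E Y comm_add_mat[of "\<phi> Y" n n "\<phi> Y * \<phi> E"] by simp
  then show ?thesis using E Y add_right_cancel_mat[of "\<phi> Y * \<phi> E" "\<phi> Y"] by simp
qed

text \<open>With s = -t - 1 the block matrix M satisfies M * M = s M. Its diagonal blocks are
  arranged so that the products EZE and ZEZ cancel in the off-diagonal equations.\<close>

lemma quad_compression:
  assumes E: "E \<in> C" "E * E = E" and Z: "Z \<in> C" and t: "E * Z * E = t \<cdot>\<^sub>m E"
  shows "quad n ((-1) \<cdot>\<^sub>m (E * Z)) E Z ((- t - 1) \<cdot>\<^sub>m One + Z * E)"
proof -
  define U V where "U = E * Z" and "V = Z * E"
  have [simp]: "U \<in> C" "V \<in> C" "E \<in> C" "Z \<in> C" using E Z by (auto simp: U_def V_def)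
  have EZE: "E * (Z * E) = t \<cdot>\<^sub>m E" using t E Z by (simp add: sq)
  have EE: "E * (E * X) = E * X" if "X \<in> C" for X
    using E that assoc_mult_mat[of E n n E n X n] by simp
  have EZE': "E * (Z * (E * X)) = t \<cdot>\<^sub>m (E * X)" if "X \<in> C" for X
  proof -
    have "E * (Z * (E * X)) = (E * (Z * E)) * X" using that by (simp add: sq)
    then show ?thesis using that by (simp add: EZE sq)
  qed
  have UU: "U * U = t \<cdot>\<^sub>m U" and UE: "U * E = t \<cdot>\<^sub>m E" and EV: "E * V = t \<cdot>\<^sub>m E"
    and VV: "V * V = t \<cdot>\<^sub>m V" and ZU: "Z * U = V * Z"
    using E by (simp_all add: U_def V_def sq EZE EZE')
  have dims: "dim_row U = n" "dim_col U = n" "dim_row V = n" "dim_col V = n" "dim_row E = n" "dim_col E = n"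
    "dim_row Z = n" "dim_col Z = n"
    using carrier_matD[OF \<open>U \<in> C\<close>] carrier_matD[OF \<open>V \<in> C\<close>] carrier_matD[OF E(1)] carrier_matD[OF Z] by auto
  have "quad n ((-1) \<cdot>\<^sub>m U) E Z ((- t - 1) \<cdot>\<^sub>m One + V)"
  \<comment> \<open>The off-diagonal equations would hold for any s. The diagonal ones reduce to (t
    + 1 + s) EZ = 0 and (t + 1 + s) ZE = 0, which dictates this value.\<close>
  proof (rule quadI[where s = "- t - 1"])
    have "(-1) \<cdot>\<^sub>m U * ((-1) \<cdot>\<^sub>m U) + U = (- t - 1) \<cdot>\<^sub>m ((-1) \<cdot>\<^sub>m U)"
      by (simp add: sq UU) (intro eq_matI, auto simp: dims algebra_simps)
    then show "(-1) \<cdot>\<^sub>m U * ((-1) \<cdot>\<^sub>m U) + E * Z = (- t - 1) \<cdot>\<^sub>m ((-1) \<cdot>\<^sub>m U)" by (simp add: U_def)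
    show "(-1) \<cdot>\<^sub>m U * E + E * ((- t - 1) \<cdot>\<^sub>m One + V) = (- t - 1) \<cdot>\<^sub>m E"
      by (simp add: sq UE EV) (intro eq_matI, auto simp: dims algebra_simps)
    have "(-1) \<cdot>\<^sub>m (V * Z) + ((- t - 1) \<cdot>\<^sub>m Z + V * Z) = (- t - 1) \<cdot>\<^sub>m Z"
      by (intro eq_matI) (auto simp: dims algebra_simps simp del: index_mult_mat(1))
    then show "Z * ((-1) \<cdot>\<^sub>m U) + ((- t - 1) \<cdot>\<^sub>m One + V) * Z = (- t - 1) \<cdot>\<^sub>m Z"
      by (simp add: sq ZU dims)
    have "V + ((- t - 1) \<cdot>\<^sub>m One + V) * ((- t - 1) \<cdot>\<^sub>m One + V) = (- t - 1) \<cdot>\<^sub>m ((- t - 1) \<cdot>\<^sub>m One + V)"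
      by (simp add: sq VV) (intro eq_matI, auto simp: dims algebra_simps)
    then show "Z * E + ((- t - 1) \<cdot>\<^sub>m One + V) * ((- t - 1) \<cdot>\<^sub>m One + V) = (- t - 1) \<cdot>\<^sub>m ((- t - 1) \<cdot>\<^sub>m One + V)"
      by (simp add: V_def)
  qed auto
  then show ?thesis by (simp add: U_def V_def)
qed

text \<open>In \<open>quad_compression\<close> only the lower left block sees the part of \<open>Z\<close> outside \<open>E * Z\<close> and
  \<open>Z * E\<close>. In the image, the (1,2) equation fixes the trace parameter, and the (1,1) equation fixes
  the determinant parameter because \<open>\<phi> E\<close> is an idempotent other than 1.\<close>

lemma phi_compression_determined:
  assumes E: "E \<in> C" "E * E = E" "E \<noteq> Null" "E \<noteq> One" and Z: "Z1 \<in> C" "Z2 \<in> C"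
    and t: "E * Z1 * E = t \<cdot>\<^sub>m E"
    and eq: "E * Z1 = E * Z2" "Z1 * E = Z2 * E"
  shows "\<phi> E * \<phi> Z1 = \<phi> E * \<phi> Z2" "\<phi> Z1 * \<phi> E = \<phi> Z2 * \<phi> E"
proof -
  define X W where "X = (-1) \<cdot>\<^sub>m (E * Z1)" and "W = (- t - 1) \<cdot>\<^sub>m One + Z1 * E"
  have [simp]: "X \<in> C" "W \<in> C" "E \<in> C" "Z1 \<in> C" "Z2 \<in> C" using E Z by (auto simp: X_def W_def)
  let ?E = "\<phi> E" and ?X = "\<phi> X" and ?W = "\<phi> W" and ?Z1 = "\<phi> Z1" and ?Z2 = "\<phi> Z2"
  have "quad n X E Z1 W" "quad n X E Z2 W"
    using quad_compression[OF E(1,2) Z(1), of t] quad_compression[OF E(1,2) Z(2), of t] t eq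
    by (simp_all add: X_def W_def)
  then have "quad n ?X ?E ?Z1 ?W" "quad n ?X ?E ?Z2 ?W" by (simp_all add: quad_iff)
  then obtain s1 p1 s2 p2 where
    1: "?X * ?X + ?E * ?Z1 + p1 \<cdot>\<^sub>m One = s1 \<cdot>\<^sub>m ?X" "?X * ?E + ?E * ?W = s1 \<cdot>\<^sub>m ?E"
     "?Z1 * ?E + ?W * ?W + p1 \<cdot>\<^sub>m One = s1 \<cdot>\<^sub>m ?W" and
    2: "?X * ?X + ?E * ?Z2 + p2 \<cdot>\<^sub>m One = s2 \<cdot>\<^sub>m ?X" "?X * ?E + ?E * ?W = s2 \<cdot>\<^sub>m ?E"
     "?Z2 * ?E + ?W * ?W + p2 \<cdot>\<^sub>m One = s2 \<cdot>\<^sub>m ?W"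
    by (elim quadE) blast
  have "s1 = s2" using smult_cancel[of ?E s1 s2] 1(2) 2(2) E phi_eq_zero_iff by simp
  with 1 2 have a: "?X * ?X + ?E * ?Z1 + p1 \<cdot>\<^sub>m One = ?X * ?X + ?E * ?Z2 + p2 \<cdot>\<^sub>m One"
    and b: "?Z1 * ?E + ?W * ?W + p1 \<cdot>\<^sub>m One = ?Z2 * ?E + ?W * ?W + p2 \<cdot>\<^sub>m One" by simp_all
  have a': "?E * ?Z1 + p1 \<cdot>\<^sub>m One = ?E * ?Z2 + p2 \<cdot>\<^sub>m One"
  proof (rule eq_matI)
    fix i j assume "i < dim_row (?E * ?Z2 + p2 \<cdot>\<^sub>m One)" "j < dim_col (?E * ?Z2 + p2 \<cdot>\<^sub>m One)"
    then show "(?E * ?Z1 + p1 \<cdot>\<^sub>m One) $$ (i, j) = (?E * ?Z2 + p2 \<cdot>\<^sub>m One) $$ (i, j)"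
      using arg_cong[OF a, of "\<lambda>M. M $$ (i, j)"] by (simp add: algebra_simps del: index_mult_mat(1))
  qed auto
  \<comment> \<open>Left multiplication by the idempotent \<open>?E\<close> keeps
    \<open>?E * ?Z1\<close> and replaces the scalar term by a multiple of \<open>?E\<close>. At an
    entry where \<open>?E\<close> and 1 differ, this and the original equation give two values of
    the same affine functions.\<close>
  have "?E * (?E * Y) = ?E * Y" if "Y \<in> C" for Y
    using that phi_idempotent[OF E(1,2)] assoc_mult_mat[of ?E n n ?E n Y n] by simp
  then have a'': "?E * ?Z1 + p1 \<cdot>\<^sub>m ?E = ?E * ?Z2 + p2 \<cdot>\<^sub>m ?E"
    using arg_cong[OF a', of "\<lambda>M. ?E * M"] by (simp add: sq)
  have "?E \<noteq> One" using E phi_eq_one_iff by simp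
  then obtain i j where ij: "i < n" "j < n" "?E $$ (i, j) \<noteq> One $$ (i, j)"
    using mat_neqD[of ?E One] by auto
  have "(?E * ?Z1) $$ (i, j) + p1 * One $$ (i, j) = (?E * ?Z2) $$ (i, j) + p2 * One $$ (i, j)"
    using arg_cong[OF a', of "\<lambda>M. M $$ (i, j)"] ij by (simp del: index_mult_mat(1))
  moreover have "(?E * ?Z1) $$ (i, j) + p1 * ?E $$ (i, j) = (?E * ?Z2) $$ (i, j) + p2 * ?E $$ (i, j)"
    using arg_cong[OF a'', of "\<lambda>M. M $$ (i, j)"] ij by (simp del: index_mult_mat(1))
  ultimately have p: "p1 = p2" using affine_coincidence ij(3) by metis
  show "?E * ?Z1 = ?E * ?Z2"
  proof (rule eq_matI)
    fix i j assume "i < dim_row (?E * ?Z2)" "j < dim_col (?E * ?Z2)"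
    then show "(?E * ?Z1) $$ (i, j) = (?E * ?Z2) $$ (i, j)"
      using arg_cong[OF a', of "\<lambda>M. M $$ (i, j)"] by (simp add: p del: index_mult_mat(1))
  qed auto
  show "?Z1 * ?E = ?Z2 * ?E"
  proof (rule eq_matI)
    fix i j assume "i < dim_row (?Z2 * ?E)" "j < dim_col (?Z2 * ?E)"
    then show "(?Z1 * ?E) $$ (i, j) = (?Z2 * ?E) $$ (i, j)"
      using arg_cong[OF b, of "\<lambda>M. M $$ (i, j)"] by (simp add: p del: index_mult_mat(1))
  qed auto
qed

end

section \<open>Preservers fixing the diagonal matrix units\<close>

lemma mat_unit_idempotent:
  "i < n \<Longrightarrow> mat_unit n i i * mat_unit n i i = (mat_unit n i i :: 'a::comm_ring_1 mat)"
  by (intro eq_matI) (auto simp: mat_unit_mult_left simp del: index_mult_mat(1))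

text \<open>The rank one idempotent with column e_i and row e_i - c e_k. Multiplying by it on the
  left reads off row i minus c times row k; multiplying on the right sees only column i.\<close>

definition shear :: "nat \<Rightarrow> nat \<Rightarrow> nat \<Rightarrow> 'a::comm_ring_1 \<Rightarrow> 'a mat" where
  "shear n i k c = mat_unit n i i + (- c) \<cdot>\<^sub>m mat_unit n i k"

lemma shear_carrier [simp]: "shear n i k c \<in> carrier_mat n n"
  by (simp add: shear_def)

lemma shear_dim [simp]: "dim_row (shear n i k c) = n" "dim_col (shear n i k c) = n"
  by (simp_all add: shear_def)

lemma shear_index:
  "a < n \<Longrightarrow> b < n \<Longrightarrow> i \<noteq> k \<Longrightarrow>
   shear n i k c $$ (a, b) = (if a = i then if b = i then 1 else if b = k then - c else 0 else 0)"
  by (simp add: shear_def)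

lemma shear_mult_left:
  assumes Z: "Z \<in> carrier_mat n n" and ik: "i < n" "k < n" "i \<noteq> k" and ab: "a < n" "b < n"
  shows "(shear n i k c * Z) $$ (a, b) = (if a = i then Z $$ (i, b) - c * Z $$ (k, b) else 0)"
proof -
  have "shear n i k c * Z = mat_unit n i i * Z + (- c) \<cdot>\<^sub>m (mat_unit n i k * Z)"
    using Z by (simp add: shear_def square_mat_simps[where m=n])
  then show ?thesis
    using assms by (simp add: mat_unit_mult_left del: index_mult_mat(1))
qed

lemma shear_mult_right:
  assumes Z: "Z \<in> carrier_mat n n" and ik: "i < n" "k < n" "i \<noteq> k" and ab: "a < n" "b < n"
  shows "(Z * shear n i k c) $$ (a, b) = (if b = i then Z $$ (a, i) else if b = k then - c * Z $$ (a, i) else 0)"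
proof -
  have "Z * shear n i k c = Z * mat_unit n i i + (- c) \<cdot>\<^sub>m (Z * mat_unit n i k)"
    using Z by (simp add: shear_def square_mat_simps[where m=n])
  then show ?thesis
    using assms by (simp add: mat_unit_mult_right del: index_mult_mat(1))
qed

lemma shear_idempotent:
  assumes "i < n" "k < n" "i \<noteq> k"
  shows "shear n i k c * shear n i k c = shear n i k c"
  using assms by (intro eq_matI) (auto simp: shear_mult_left shear_index simp del: index_mult_mat(1))

locale diagonal_quad_preserver = unital_quad_preserver +
  assumes phi_diag: "i < n \<Longrightarrow> \<phi> (mat_unit n i i) = mat_unit n i i"
begin

lemma neq_one_if_zero_row:
  assumes "k < n" "\<And>m. m < n \<Longrightarrow> E $$ (k, m) = 0"
  shows "E \<noteq> One"
proof
  assume "E = One"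
  from arg_cong[OF this, of "\<lambda>M. M $$ (k, k)"] show False using assms by simp
qed

text \<open>The room provided by \<open>n \<ge> 3\<close>: removing the influence of entry (j, i) on
  entry (i, j) takes a row other than both.\<close>

lemma third_index: assumes "i < n" "j < n" obtains k where "k < n" "k \<noteq> i" "k \<noteq> j"
proof -
  have "card {i, j} < card {..<n}" using n3 card_insert_le_m1[of 2 "{j}" i] by simp
  then have "\<not> {..<n} \<subseteq> {i, j}" by (metis card_mono finite.emptyI finite_insert not_le)
  then show ?thesis using that by auto
qed

lemma mat_unit_neq_one: assumes i: "i < n" shows "mat_unit n i i \<noteq> One"
proof -
  obtain k where k: "k < n" "k \<noteq> i" using third_index[OF i i] by metis
  show ?thesis by (rule neq_one_if_zero_row[OF k(1)]) (use k in simp)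
qed

text \<open>For \<open>E = mat_unit n i i\<close> the products EZ and ZE are row i and column i of
  Z, and the image of E is E itself.\<close>

lemma phi_cross:
  assumes i: "i < n" and Z: "Z1 \<in> C" "Z2 \<in> C"
    and row: "\<And>m. m < n \<Longrightarrow> Z1 $$ (i, m) = Z2 $$ (i, m)"
    and col: "\<And>m. m < n \<Longrightarrow> Z1 $$ (m, i) = Z2 $$ (m, i)" and m: "m < n"
  shows "\<phi> Z1 $$ (i, m) = \<phi> Z2 $$ (i, m)" "\<phi> Z1 $$ (m, i) = \<phi> Z2 $$ (m, i)"
proof -
  let ?E = "mat_unit n i i :: 'a mat"
  have t: "?E * Z1 * ?E = (Z1 $$ (i, i)) \<cdot>\<^sub>m ?E"
    using i Z by (intro eq_matI) (auto simp: mat_unit_mult_right mat_unit_mult_left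
        simp del: index_mult_mat(1) assoc_mult_mat)
  have "?E * Z1 = ?E * Z2" "Z1 * ?E = Z2 * ?E"
    using i Z row col by (auto intro!: eq_matI simp: mat_unit_mult_right mat_unit_mult_left
        simp del: index_mult_mat(1))
  from phi_compression_determined[OF _ mat_unit_idempotent[OF i] mat_unit_neq_zero[OF i] mat_unit_neq_one[OF i] Z t this]
  have eq: "?E * \<phi> Z1 = ?E * \<phi> Z2" "\<phi> Z1 * ?E = \<phi> Z2 * ?E" by (simp_all add: phi_diag i)
  show "\<phi> Z1 $$ (i, m) = \<phi> Z2 $$ (i, m)"
    using arg_cong[OF eq(1), of "\<lambda>M. M $$ (i, m)"] i m Z
    by (simp add: mat_unit_mult_left del: index_mult_mat(1))
  show "\<phi> Z1 $$ (m, i) = \<phi> Z2 $$ (m, i)"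
    using arg_cong[OF eq(2), of "\<lambda>M. M $$ (m, i)"] i m Z
    by (simp add: mat_unit_mult_right del: index_mult_mat(1))
qed

definition coef :: "nat \<Rightarrow> nat \<Rightarrow> 'a" where
  "coef i k = - (\<phi> (shear n i k 1) $$ (i, k))"

text \<open>The shear S satisfies E_ii S = S, S E_ii = E_ii and S E_mm = 0 for other m. These
  relations pass to the image and leave only its entry (i, k) free.\<close>

lemma phi_shear:
  assumes ik: "i < n" "k < n" "i \<noteq> k"
  shows "\<phi> (shear n i k 1) = shear n i k (coef i k)"
proof (rule eq_matI)
  let ?S = "shear n i k 1 :: 'a mat"
  have 1: "mat_unit n i i * \<phi> ?S = \<phi> ?S"
  proof -
    have "mat_unit n i i * ?S = ?S"
      using ik by (intro eq_matI) (auto simp: mat_unit_mult_left shear_index simp del: index_mult_mat(1))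
    then show ?thesis
      using phi_left_fix[of "mat_unit n i i" ?S] ik by (simp add: mat_unit_idempotent phi_diag)
  qed
  have 2: "\<phi> ?S * mat_unit n i i = mat_unit n i i"
  proof -
    have "?S * mat_unit n i i = mat_unit n i i"
      using ik by (intro eq_matI) (auto simp: mat_unit_mult_right shear_index simp del: index_mult_mat(1))
    then show ?thesis
      using phi_left_fix[of ?S "mat_unit n i i"] ik by (simp add: shear_idempotent phi_diag)
  qed
  have 3: "\<phi> ?S * mat_unit n m m = Null" if "m < n" "m \<noteq> i" "m \<noteq> k" for m
  proof -
    have "?S * mat_unit n m m = Null"
      using ik that by (intro eq_matI) (auto simp: mat_unit_mult_right shear_index simp del: index_mult_mat(1))
    then show ?thesis
      using phi_right_annihilate[of "mat_unit n m m" ?S] that by (simp add: mat_unit_idempotent phi_diag)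
  qed
  fix a b assume "a < dim_row (shear n i k (coef i k))" "b < dim_col (shear n i k (coef i k))"
  then have ab: "a < n" "b < n" by auto
  have a: "\<phi> ?S $$ (a, b) = 0" if "a \<noteq> i"
    using arg_cong[OF 1, of "\<lambda>M. M $$ (a, b)"] ab ik that
    by (simp add: mat_unit_mult_left del: index_mult_mat(1))
  have i: "\<phi> ?S $$ (i, i) = 1"
    using arg_cong[OF 2, of "\<lambda>M. M $$ (i, i)"] ik
    by (simp add: mat_unit_mult_right del: index_mult_mat(1))
  have b: "\<phi> ?S $$ (a, b) = 0" if "b \<noteq> i" "b \<noteq> k"
    using arg_cong[OF 3[OF ab(2) that], of "\<lambda>M. M $$ (a, b)"] ab ik that
    by (simp add: mat_unit_mult_right del: index_mult_mat(1))
  show "\<phi> ?S $$ (a, b) = shear n i k (coef i k) $$ (a, b)"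
    using ab ik a b i by (auto simp: shear_index coef_def)
qed (use ik in auto)

lemma coef_nonzero:
  assumes ik: "i < n" "k < n" "i \<noteq> k"
  shows "coef i k \<noteq> 0"
proof
  assume "coef i k = 0"
  then have "\<phi> (shear n i k 1) = \<phi> (mat_unit n i i)"
    using phi_shear[OF ik] ik by (simp add: phi_diag shear_def)
  then have "shear n i k 1 = (mat_unit n i i :: 'a mat)" using phi_eq_iff by simp
  from arg_cong[OF this, of "\<lambda>M. M $$ (i, k)"] show False using ik by (simp add: shear_index)
qed

text \<open>The analogue of \<open>phi_cross\<close> for a shear. Row i may now change together with
  row k, while column i stays fixed; in the image the rows are combined with \<open>coef i k\<close>
  instead of 1.\<close>

lemma phi_shear_cross:
  assumes ik: "i < n" "k < n" "i \<noteq> k" and Z: "Z1 \<in> C" "Z2 \<in> C"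
    and row: "\<And>m. m < n \<Longrightarrow> Z1 $$ (i, m) - Z1 $$ (k, m) = Z2 $$ (i, m) - Z2 $$ (k, m)"
    and col: "\<And>m. m < n \<Longrightarrow> Z1 $$ (m, i) = Z2 $$ (m, i)" and m: "m < n"
  shows "\<phi> Z1 $$ (i, m) - coef i k * \<phi> Z1 $$ (k, m) = \<phi> Z2 $$ (i, m) - coef i k * \<phi> Z2 $$ (k, m)"
    "\<phi> Z1 $$ (m, i) = \<phi> Z2 $$ (m, i)"
proof -
  let ?E = "shear n i k 1 :: 'a mat"
  have t: "?E * Z1 * ?E = (Z1 $$ (i, i) - Z1 $$ (k, i)) \<cdot>\<^sub>m ?E"
    using ik Z by (intro eq_matI) (auto simp: shear_mult_right shear_mult_left shear_index
        simp del: index_mult_mat(1) assoc_mult_mat)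
  have eq: "?E * Z1 = ?E * Z2" "Z1 * ?E = Z2 * ?E"
    using ik Z row col by (auto intro!: eq_matI simp: shear_mult_right shear_mult_left
        simp del: index_mult_mat(1))
  have "?E \<noteq> Null"
  proof
    assume "?E = Null"
    from arg_cong[OF this, of "\<lambda>M. M $$ (i, i)"] show False using ik by (simp add: shear_index)
  qed
  moreover have "?E \<noteq> One"
    by (rule neq_one_if_zero_row[OF ik(2)]) (use ik in \<open>simp add: shear_index\<close>)
  ultimately have eq: "shear n i k (coef i k) * \<phi> Z1 = shear n i k (coef i k) * \<phi> Z2"
      "\<phi> Z1 * shear n i k (coef i k) = \<phi> Z2 * shear n i k (coef i k)"
    using phi_compression_determined[OF _ shear_idempotent[OF ik] _ _ Z t eq] phi_shear[OF ik] by simp_all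
  show "\<phi> Z1 $$ (i, m) - coef i k * \<phi> Z1 $$ (k, m) = \<phi> Z2 $$ (i, m) - coef i k * \<phi> Z2 $$ (k, m)"
    using arg_cong[OF eq(1), of "\<lambda>M. M $$ (i, m)"] ik m Z
    by (simp add: shear_mult_left del: index_mult_mat(1))
  show "\<phi> Z1 $$ (m, i) = \<phi> Z2 $$ (m, i)"
    using arg_cong[OF eq(2), of "\<lambda>M. M $$ (m, i)"] ik m Z
    by (simp add: shear_mult_right del: index_mult_mat(1))
qed

definition entry_map :: "nat \<Rightarrow> nat \<Rightarrow> 'a \<Rightarrow> 'a" where
  "entry_map i j t = \<phi> (t \<cdot>\<^sub>m mat_unit n i j) $$ (i, j)"

lemma phi_off_diagonal:
  assumes ij: "i < n" "j < n" "i \<noteq> j" and Z: "Z \<in> C"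
  shows "\<phi> Z $$ (i, j) = entry_map i j (Z $$ (i, j))"
proof -
  have local: "\<phi> Z1 $$ (i, j) = \<phi> Z2 $$ (i, j)"
    if Z: "Z1 \<in> C" "Z2 \<in> C" and eq: "Z1 $$ (i, j) = Z2 $$ (i, j)" "Z1 $$ (j, i) = Z2 $$ (j, i)" for Z1 Z2
  proof -
    \<comment> \<open>The crosses through i and through j meet exactly in (i, j) and (j, i).
      \<open>M\<close> has the cross of \<open>Z1\<close> through i and, by the assumed agreement
      there, the cross of \<open>Z2\<close> through j.\<close>
    define M where "M = mat n n (\<lambda>(a, b). if a = i \<or> b = i then Z1 $$ (a, b) else Z2 $$ (a, b))"
    have "\<phi> Z1 $$ (i, j) = \<phi> M $$ (i, j)"
      using Z ij by (intro phi_cross(1)[of i]) (auto simp: M_def)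
    also have "\<dots> = \<phi> Z2 $$ (i, j)"
      using Z ij eq by (intro phi_cross(2)[of j]) (auto simp: M_def)
    finally show ?thesis .
  qed
  obtain k where k: "k < n" "k \<noteq> i" "k \<noteq> j" using third_index[OF ij(1,2)] .
  \<comment> \<open>\<open>Z1\<close> and \<open>Z2\<close> have the same difference of rows \<open>j\<close> and \<open>k\<close>, but \<open>Z2\<close> vanishes at \<open>(j, i)\<close>.\<close>
  define Z1 where "Z1 = Z $$ (i, j) \<cdot>\<^sub>m mat_unit n i j + Z $$ (j, i) \<cdot>\<^sub>m mat_unit n j i"
  define Z2 where "Z2 = Z $$ (i, j) \<cdot>\<^sub>m mat_unit n i j + (- Z $$ (j, i)) \<cdot>\<^sub>m mat_unit n k i"
  have "\<phi> Z $$ (i, j) = \<phi> Z1 $$ (i, j)" using Z ij by (intro local) (auto simp: Z1_def)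
  also have "\<dots> = \<phi> Z2 $$ (i, j)"
    using Z ij k by (intro phi_shear_cross(2)[of j k]) (auto simp: Z1_def Z2_def)
  also have "\<dots> = entry_map i j (Z $$ (i, j))"
    unfolding entry_map_def using Z ij k by (intro local) (auto simp: Z2_def)
  finally show ?thesis .
qed

lemma phi_diagonal_column:
  assumes i: "i < n" and Z: "Z1 \<in> C" "Z2 \<in> C" and col: "\<And>m. m < n \<Longrightarrow> Z1 $$ (m, i) = Z2 $$ (m, i)"
  shows "\<phi> Z1 $$ (i, i) = \<phi> Z2 $$ (i, i)"
proof -
  obtain k where k: "k < n" "k \<noteq> i" using third_index[OF i i] by metis
  \<comment> \<open>Row i is switched to that of \<open>Z2\<close>, and row k is corrected to keep
    the difference of rows i and k as in \<open>Z1\<close>. Column i is unchanged because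
    \<open>Z1\<close> and \<open>Z2\<close> agree on it.\<close>
  define M where "M = mat n n (\<lambda>(a, b). if a = i then Z2 $$ (a, b)
    else if a = k then Z1 $$ (k, b) + Z2 $$ (i, b) - Z1 $$ (i, b) else Z1 $$ (a, b))"
  have "\<phi> Z1 $$ (i, i) = \<phi> M $$ (i, i)"
    using Z i k col by (intro phi_shear_cross(2)[of i k]) (auto simp: M_def)
  also have "\<dots> = \<phi> Z2 $$ (i, i)"
    using Z i k col by (intro phi_cross(1)[of i]) (auto simp: M_def)
  finally show ?thesis .
qed

lemma entry_map_zero: "entry_map i j 0 = 0" if "i < n" "j < n"
  using that by (simp add: entry_map_def)

lemma entry_map_diag_one: "i < n \<Longrightarrow> entry_map i i 1 = 1"
  by (simp add: entry_map_def phi_diag)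

text \<open>Moving \<open>b\<close> from row k into row i with opposite sign preserves the row
  difference seen by the shear, and column i is zero as \<open>m \<noteq> i\<close>. The case
  \<open>m = k\<close> meets a diagonal entry, hence the assumption \<open>diag\<close>, later
  supplied by \<open>phi_entry\<close>.\<close>

lemma entry_map_shear:
  assumes ik: "i < n" "k < n" "i \<noteq> k" and m: "m < n" "m \<noteq> i"
    and diag: "\<And>Z. Z \<in> C \<Longrightarrow> \<phi> Z $$ (k, k) = entry_map k k (Z $$ (k, k))"
  shows "entry_map i m a - coef i k * entry_map k m b = entry_map i m (a - b)"
proof -
  define Z1 where "Z1 = a \<cdot>\<^sub>m mat_unit n i m + b \<cdot>\<^sub>m mat_unit n k m"
  define Z2 where "Z2 = (a - b) \<cdot>\<^sub>m mat_unit n i m"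
  have Z [simp]: "Z1 \<in> C" "Z2 \<in> C" by (simp_all add: Z1_def Z2_def)
  have km: "\<phi> Z $$ (k, m) = entry_map k m (Z $$ (k, m))" if "Z \<in> C" for Z
    using phi_off_diagonal[of k m Z] diag[of Z] that ik m by (cases "k = m") auto
  have "\<phi> Z1 $$ (i, m) - coef i k * \<phi> Z1 $$ (k, m) = \<phi> Z2 $$ (i, m) - coef i k * \<phi> Z2 $$ (k, m)"
    using ik m by (intro phi_shear_cross(1)) (auto simp: Z1_def Z2_def)
  then have "entry_map i m (Z1 $$ (i, m)) - coef i k * entry_map k m (Z1 $$ (k, m)) =
      entry_map i m (Z2 $$ (i, m)) - coef i k * entry_map k m (Z2 $$ (k, m))"
    using ik m by (simp add: km phi_off_diagonal)
  moreover have "Z1 $$ (i, m) = a" "Z1 $$ (k, m) = b" "Z2 $$ (i, m) = a - b" "Z2 $$ (k, m) = 0"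
    using ik m by (auto simp: Z1_def Z2_def)
  ultimately show ?thesis using ik m by (simp add: entry_map_zero)
qed

end

section \<open>Diagonal scaling matrices\<close>

definition scaling :: "nat \<Rightarrow> (nat \<Rightarrow> 'a::comm_ring_1) \<Rightarrow> 'a mat" where
  "scaling n d = mat n n (\<lambda>(i, j). if i = j then d i else 0)"

lemma scaling_carrier [simp]: "scaling n d \<in> carrier_mat n n"
  by (simp add: scaling_def)

lemma scaling_dim [simp]: "dim_row (scaling n d) = n" "dim_col (scaling n d) = n"
  by (simp_all add: scaling_def)

lemma scaling_index: "i < n \<Longrightarrow> j < n \<Longrightarrow> scaling n d $$ (i, j) = (if i = j then d i else 0)"
  by (simp add: scaling_def)

lemma scaling_mult_left:
  assumes "Z \<in> carrier_mat n n" "i < n" "j < n"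
  shows "(scaling n d * Z) $$ (i, j) = d i * Z $$ (i, j)"
proof -
  have "(scaling n d * Z) $$ (i, j) = (\<Sum>k<n. if k = i then d i * Z $$ (i, j) else 0)"
    unfolding index_mult_sum[OF scaling_carrier assms] using assms(2)
    by (intro sum.cong) (auto simp: scaling_index)
  then show ?thesis using assms by simp
qed

lemma scaling_mult_right:
  assumes "Z \<in> carrier_mat n n" "i < n" "j < n"
  shows "(Z * scaling n d) $$ (i, j) = Z $$ (i, j) * d j"
proof -
  have "(Z * scaling n d) $$ (i, j) = (\<Sum>k<n. if k = j then Z $$ (i, j) * d j else 0)"
    unfolding index_mult_sum[OF assms(1) scaling_carrier assms(2-)] using assms(3)
    by (intro sum.cong) (auto simp: scaling_index)
  then show ?thesis using assms by simp
qed

lemma scaling_mult_inverse: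
  assumes "\<And>i. i < n \<Longrightarrow> d i * e i = 1"
  shows "scaling n d * scaling n e = 1\<^sub>m n"
  using assms by (intro eq_matI) (auto simp: scaling_mult_left scaling_index simp del: index_mult_mat(1))

lemma sum_first_two:
  fixes F :: "nat \<Rightarrow> 'a::comm_monoid_add"
  assumes "n \<ge> 2" "\<And>k. k \<ge> 2 \<Longrightarrow> F k = 0"
  shows "(\<Sum>k<n. F k) = F 0 + F 1"
proof -
  have "(\<Sum>k<n. F k) = (\<Sum>k\<in>{0, 1}. F k)"
    by (rule sum.mono_neutral_right) (use assms in auto)
  then show ?thesis by simp
qed

section \<open>The common scalar function and its weights\<close>

context diagonal_quad_preserver
begin

lemma transpose_diagonal: "diagonal_quad_preserver n (\<lambda>X. transpose_mat (\<phi> (transpose_mat X)))"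
proof -
  interpret t: quad_preserver n "\<lambda>X. transpose_mat (\<phi> (transpose_mat X))" by (rule transpose)
  have "transpose_mat (mat_unit n i i) = (mat_unit n i i :: 'a mat)" for i :: nat
    by (intro eq_matI) auto
  then show ?thesis by unfold_locales (simp_all add: phi_diag)
qed

lemma phi_diagonal_row:
  assumes i: "i < n" and Z: "Z1 \<in> C" "Z2 \<in> C" and row: "\<And>m. m < n \<Longrightarrow> Z1 $$ (i, m) = Z2 $$ (i, m)"
  shows "\<phi> Z1 $$ (i, i) = \<phi> Z2 $$ (i, i)"
proof -
  interpret t: diagonal_quad_preserver n "\<lambda>X. transpose_mat (\<phi> (transpose_mat X))"
    by (rule transpose_diagonal)
  show ?thesis
    using t.phi_diagonal_column[OF i, of "transpose_mat Z1" "transpose_mat Z2"] i Z row by simp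
qed

text \<open>A diagonal entry of the image is determined by its column alone and also by its row
  alone; keeping only column i and then only row i leaves the single entry (i, i).\<close>

lemma phi_entry:
  assumes ij: "i < n" "j < n" and Z: "Z \<in> C"
  shows "\<phi> Z $$ (i, j) = entry_map i j (Z $$ (i, j))"
proof (cases "i = j")
  case True
  define M where "M = mat n n (\<lambda>(a, b). if b = i then Z $$ (a, b) else 0)"
  have "\<phi> Z $$ (i, i) = \<phi> M $$ (i, i)"
    using ij Z by (intro phi_diagonal_column) (auto simp: M_def)
  also have "\<dots> = entry_map i i (Z $$ (i, i))"
    unfolding entry_map_def using ij Z by (intro phi_diagonal_row) (auto simp: M_def)
  finally show ?thesis using True by simp
qed (use phi_off_diagonal assms in simp)

text \<open>Equal arguments in the shear identity give proportionality, since the map at 0 vanishes.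
  Substituting this back turns the identity into additivity.\<close>

lemma entry_map_row:
  assumes ik: "i < n" "k < n" "i \<noteq> k" and m: "m < n" "m \<noteq> i"
  shows "entry_map i m a = coef i k * entry_map k m a"
    "entry_map i m (a - b) = entry_map i m a - entry_map i m b"
proof -
  note shear = entry_map_shear[OF ik m phi_entry[OF ik(2,2)]]
  show *: "entry_map i m a = coef i k * entry_map k m a" for a
    using shear[of a a] ik m by (simp add: entry_map_zero)
  show "entry_map i m (a - b) = entry_map i m a - entry_map i m b"
    using shear[of a b] *[of b] by simp
qed

text \<open>\<open>entry_map_row\<close> for the transposed preserver. The factor is existential
  because it is the coefficient of that other map.\<close>

lemma entry_map_column:
  assumes ik: "i < n" "k < n" "i \<noteq> k"
  shows "\<exists>d. \<forall>a. entry_map k i a = d * entry_map k k a"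
proof -
  interpret t: diagonal_quad_preserver n "\<lambda>X. transpose_mat (\<phi> (transpose_mat X))"
    by (rule transpose_diagonal)
  have "transpose_mat (a \<cdot>\<^sub>m mat_unit n p q) = a \<cdot>\<^sub>m mat_unit n q p" for p q and a :: 'a
    by (intro eq_matI) auto
  then have tr: "t.entry_map p q a = entry_map q p a" if "p < n" "q < n" for p q a
    using that by (simp add: t.entry_map_def entry_map_def)
  show ?thesis
    using t.entry_map_row(1)[OF ik ik(2) ik(3)[symmetric]] tr ik by auto
qed

text \<open>The map at (i, k) is a multiple of both diagonal maps. Their common value 1 at 1 makes
  the two factors equal, and the factor is nonzero.\<close>

lemma entry_map_diagonal_eq:
  assumes ik: "i < n" "k < n"
  shows "entry_map i i = entry_map k k"
proof (cases "i = k")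
  case False
  obtain d where d: "\<And>a. entry_map i k a = d * entry_map i i a"
    using entry_map_column[of k i] ik False by auto
  have c: "entry_map i k a = coef i k * entry_map k k a" for a
    using entry_map_row(1)[of i k k] ik False by simp
  have "d = coef i k" using d[of 1] c[of 1] ik by (simp add: entry_map_diag_one)
  then show ?thesis using d c coef_nonzero[OF ik False] by (auto simp: fun_eq_iff)
qed simp

definition scalar_map :: "'a \<Rightarrow> 'a" where
  "scalar_map = entry_map 0 0"

definition weight :: "nat \<Rightarrow> nat \<Rightarrow> 'a" where
  "weight i j = (if i = j then 1 else coef i j)"

lemma phi_entry_weight:
  assumes ij: "i < n" "j < n" and Z: "Z \<in> C"
  shows "\<phi> Z $$ (i, j) = weight i j * scalar_map (Z $$ (i, j))"
proof -
  have "entry_map j j = scalar_map"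
    unfolding scalar_map_def using ij n3 by (intro entry_map_diagonal_eq) auto
  then show ?thesis
    using phi_entry[OF assms] entry_map_row(1)[of i j j] ij by (cases "i = j") (auto simp: weight_def)
qed

lemma weight_nonzero: "i < n \<Longrightarrow> j < n \<Longrightarrow> weight i j \<noteq> 0"
  by (simp add: weight_def coef_nonzero)

lemma scalar_map_one: "scalar_map 1 = 1"
  using n3 by (simp add: scalar_map_def entry_map_diag_one)

lemma scalar_map_zero: "scalar_map 0 = 0"
  using n3 by (simp add: scalar_map_def entry_map_zero)

lemma entry_map_weight: "i < n \<Longrightarrow> j < n \<Longrightarrow> entry_map i j a = weight i j * scalar_map a"
  using phi_entry_weight[of i j "a \<cdot>\<^sub>m mat_unit n i j"] by (simp add: entry_map_def)

lemma weight_mult: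
  assumes "i < n" "k < n" "m < n" "i \<noteq> k" "k \<noteq> m" "m \<noteq> i"
  shows "weight i k * weight k m = weight i m"
proof -
  have "entry_map i m 1 = coef i k * entry_map k m 1"
    using entry_map_row(1)[of i k m] assms by simp
  then show ?thesis using assms by (simp add: entry_map_weight scalar_map_one) (simp add: weight_def)
qed

text \<open>The cocycle rule \<open>weight_mult\<close> demands distinct indices, so the pair i, j
  is tested against \<open>weight i k\<close> for a third index k.\<close>

lemma weight_inverse:
  assumes ij: "i < n" "j < n"
  shows "weight i j * weight j i = 1"
proof (cases "i = j")
  case False
  obtain k where k: "k < n" "k \<noteq> i" "k \<noteq> j" using third_index[OF ij] .
  have "weight i j * (weight j i * weight i k) = weight i k"
    using weight_mult[of j i k] weight_mult[of i j k] ij k False by simp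
  then show ?thesis using weight_nonzero[OF ij(1) k(1)] by (simp flip: mult.assoc)
qed (simp add: weight_def)

text \<open>The coboundary form: \<open>weight 0 j\<close> is the inverse of
  \<open>weight j 0\<close>, so the weights come from conjugation by a diagonal matrix.\<close>

lemma weight_quotient:
  assumes ij: "i < n" "j < n"
  shows "weight i j = weight i 0 * weight 0 j"
proof -
  consider "i = j" | "i = 0" | "j = 0" | "i \<noteq> j" "i \<noteq> 0" "j \<noteq> 0" by blast
  then show ?thesis
  proof cases
    case 1
    then show ?thesis using weight_inverse[of i 0] ij n3 by (simp add: weight_def)
  next
    case 4
    then show ?thesis using weight_mult[of i 0 j] ij n3 by simp
  qed (simp_all add: weight_def)
qed

lemma scalar_map_diff: "scalar_map (a - b) = scalar_map a - scalar_map b"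
proof -
  \<comment> \<open>Additivity is available only off the diagonal, so it is read at entry (1, 0) and
    the weight is cancelled.\<close>
  have "weight 1 0 * scalar_map (a - b) = weight 1 0 * (scalar_map a - scalar_map b)"
    using entry_map_row(2)[of 1 0 0 a b] n3 by (simp add: entry_map_weight algebra_simps)
  then show ?thesis using weight_nonzero[of 1 0] n3 by simp
qed

lemma scalar_map_add: "scalar_map (a + b) = scalar_map a + scalar_map b"
  using scalar_map_diff[of a "- b"] scalar_map_diff[of 0 b] by (simp add: scalar_map_zero)

lemma scalar_map_square: "scalar_map (u * u) = scalar_map u * scalar_map u"
proof -
  \<comment> \<open>The rank one idempotent \<open>(u, 1; u - u\<^sup>2, 1 - u)\<close> in the upper left corner.\<close>
  define p q :: "nat \<Rightarrow> 'a" where "p k = (if k = 0 then 1 else if k = 1 then 1 - u else 0)"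
    and "q k = (if k = 0 then u else if k = 1 then 1 else 0)" for k
  define U where "U = mat n n (\<lambda>(a, b). p a * q b)"
  have U: "U \<in> C" by (simp add: U_def)
  have "U * U = U"
  proof (rule eq_matI)
    fix a b assume "a < dim_row U" "b < dim_col U"
    then have ab: "a < n" "b < n" by (auto simp: U_def)
    have "(U * U) $$ (a, b) = (\<Sum>k<n. p a * q k * (p k * q b))"
      unfolding index_mult_sum[OF U U ab] using ab by (intro sum.cong) (auto simp: U_def)
    also have "\<dots> = p a * q 0 * (p 0 * q b) + p a * q 1 * (p 1 * q b)"
      using n3 by (intro sum_first_two) (auto simp: q_def)
    also have "\<dots> = U $$ (a, b)" using ab by (simp add: U_def p_def q_def algebra_simps)
    finally show "(U * U) $$ (a, b) = U $$ (a, b)" .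
  qed (auto simp: U_def)
  then have idem: "\<phi> U * \<phi> U = \<phi> U" by (rule phi_idempotent[OF U])
  have ent: "\<phi> U $$ (a, b) = weight a b * scalar_map (p a * q b)" if "a < n" "b < n" for a b
    using that phi_entry_weight[OF that U] by (simp add: U_def)
  have n: "0 < n" "1 < n" using n3 by auto
  \<comment> \<open>In the (0, 0) entry of the idempotence relation the two off-diagonal weights
    cancel, leaving f(u) = f(u) f(u) + f(u - u u) for f = \<open>scalar_map\<close>.\<close>
  have "\<phi> U $$ (0, 0) = (\<Sum>k<n. \<phi> U $$ (0, k) * \<phi> U $$ (k, 0))"
    using index_mult_sum[of "\<phi> U" n "\<phi> U" 0 0] U n idem by simp
  also have "\<dots> = (\<Sum>k<n. weight 0 k * scalar_map (p 0 * q k) * (weight k 0 * scalar_map (p k * q 0)))"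
    using n by (intro sum.cong) (auto simp: ent)
  also have "\<dots> = weight 0 0 * scalar_map (p 0 * q 0) * (weight 0 0 * scalar_map (p 0 * q 0))
      + weight 0 1 * scalar_map (p 0 * q 1) * (weight 1 0 * scalar_map (p 1 * q 0))"
    using n3 by (intro sum_first_two) (auto simp: q_def scalar_map_zero)
  also have "\<dots> = scalar_map u * scalar_map u + (weight 0 1 * weight 1 0) * scalar_map ((1 - u) * u)"
    by (simp add: p_def q_def scalar_map_one) (simp add: weight_def)
  also have "\<dots> = scalar_map u * scalar_map u + (scalar_map u - scalar_map (u * u))"
    using weight_inverse[OF n] by (simp add: left_diff_distrib scalar_map_diff)
  also have "\<phi> U $$ (0, 0) = scalar_map u"
    using ent[OF n(1) n(1)] by (simp add: p_def q_def weight_def)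
  finally show ?thesis by simp
qed

text \<open>Polarization of \<open>scalar_map_square\<close>, using additivity and division by
  2.\<close>

lemma scalar_map_mult: "scalar_map (a * b) = scalar_map a * scalar_map b"
proof -
  have "scalar_map ((a + b) * (a + b)) = (scalar_map a + scalar_map b) * (scalar_map a + scalar_map b)"
    by (simp add: scalar_map_square scalar_map_add)
  moreover have "scalar_map ((a + b) * (a + b)) =
      scalar_map a * scalar_map a + (scalar_map (a * b) + scalar_map (a * b)) + scalar_map b * scalar_map b"
  proof -
    have "(a + b) * (a + b) = a * a + (a * b + a * b) + b * b" by (simp add: algebra_simps)
    then show ?thesis by (simp only: scalar_map_add scalar_map_square)
  qed
  ultimately have "2 * scalar_map (a * b) = 2 * (scalar_map a * scalar_map b)"
    by (simp add: algebra_simps)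
  then show ?thesis by simp
qed

lemma scalar_map_automorphism: "field_automorphism scalar_map"
proof -
  have n: "0 < n" using n3 by simp
  have "inj scalar_map"
  proof (rule injI)
    fix a b assume eq: "scalar_map a = scalar_map b"
    have "\<phi> (a \<cdot>\<^sub>m mat_unit n 0 0) = \<phi> (b \<cdot>\<^sub>m mat_unit n 0 0)"
      by (intro eq_matI) (auto simp: phi_entry_weight eq)
    then have "a \<cdot>\<^sub>m mat_unit n 0 0 = b \<cdot>\<^sub>m mat_unit n 0 0" by (simp add: phi_eq_iff)
    from arg_cong[OF this, of "\<lambda>M. M $$ (0, 0)"] show "a = b" using n by simp
  qed
  moreover have "surj scalar_map"
  proof (rule surjI)
    fix y
    \<comment> \<open>The entry (0, 0) of any preimage of this matrix is a preimage of
      \<open>y\<close>, because the action is entrywise with weight 1 there.\<close>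
    let ?X = "SOME X. X \<in> C \<and> \<phi> X = y \<cdot>\<^sub>m mat_unit n 0 0"
    have X: "?X \<in> C \<and> \<phi> ?X = y \<cdot>\<^sub>m mat_unit n 0 0"
      by (rule someI_ex) (metis phi_surj smult_carrier_mat mat_unit_carrier)
    then show "scalar_map (?X $$ (0, 0)) = y"
      using phi_entry_weight[OF n n, of ?X] n by (simp add: weight_def)
  qed
  ultimately show ?thesis
    by (simp add: field_automorphism_def bij_def scalar_map_add scalar_map_mult)
qed

lemma semilinear: "semilinear_conjugation n \<phi>"
proof -
  let ?A = "scaling n (\<lambda>i. weight i 0)" and ?B = "scaling n (\<lambda>i. weight 0 i)"
  have n: "0 < n" using n3 by simp
  have "?A * ?B = One" "?B * ?A = One"
    using weight_inverse n by (auto intro: scaling_mult_inverse)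
  moreover have "\<phi> T = 1 \<cdot>\<^sub>m (?A * map_mat scalar_map T * ?B)" if T: "T \<in> C" for T
  proof (rule eq_matI)
    fix i j assume "i < dim_row (1 \<cdot>\<^sub>m (?A * map_mat scalar_map T * ?B))"
      "j < dim_col (1 \<cdot>\<^sub>m (?A * map_mat scalar_map T * ?B))"
    then have ij: "i < n" "j < n" by auto
    have "(?A * map_mat scalar_map T * ?B) $$ (i, j) = weight i 0 * scalar_map (T $$ (i, j)) * weight 0 j"
      using ij T by (subst scaling_mult_right, simp_all add: scaling_mult_left del: index_mult_mat(1))
    then show "\<phi> T $$ (i, j) = (1 \<cdot>\<^sub>m (?A * map_mat scalar_map T * ?B)) $$ (i, j)"
      using phi_entry_weight[OF ij T] weight_quotient[OF ij] by simp
  qed (use T in auto)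
  ultimately show ?thesis
    unfolding semilinear_conjugation_def using scalar_map_automorphism by (metis scaling_carrier)
qed

end

section \<open>Undoing the normalizations\<close>

lemma semilinear_conjugation_of_conjugate:
  fixes \<phi> :: "'a::field mat \<Rightarrow> 'a mat"
  assumes A: "A \<in> carrier_mat n n" and B: "B \<in> carrier_mat n n"
    and AB: "A * B = 1\<^sub>m n" "B * A = 1\<^sub>m n" and c: "c \<noteq> 0"
    and \<phi>: "\<And>X. X \<in> carrier_mat n n \<Longrightarrow> \<phi> X \<in> carrier_mat n n"
    and std: "semilinear_conjugation n (\<lambda>X. c \<cdot>\<^sub>m (A * \<phi> X * B))"
  shows "semilinear_conjugation n \<phi>"
proof -
  obtain A' B' c' \<tau> where A': "A' \<in> carrier_mat n n" and B': "B' \<in> carrier_mat n n"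
    and AB': "A' * B' = 1\<^sub>m n" "B' * A' = 1\<^sub>m n" and \<tau>: "field_automorphism \<tau>"
    and eq: "\<And>T. T \<in> carrier_mat n n \<Longrightarrow> c \<cdot>\<^sub>m (A * \<phi> T * B) = c' \<cdot>\<^sub>m (A' * map_mat \<tau> T * B')"
    using std unfolding semilinear_conjugation_def by blast
  have cancel: "X * (Y * Z) = Z" if "X * Y = 1\<^sub>m n" "X \<in> carrier_mat n n" "Y \<in> carrier_mat n n" "Z \<in> carrier_mat n n"
    for X Y Z :: "'a mat"
    using that assoc_mult_mat[of X n n Y n Z n] by simp
  note [simp] = cancel[OF AB(1) A B] cancel[OF AB(2) B A] cancel[OF AB'(1) A' B'] cancel[OF AB'(2) B' A']
  \<comment> \<open>Solving for the original map gives conjugation by \<open>B * A'\<close>, with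
    inverse \<open>B' * A\<close>, and the scalar \<open>c' / c\<close>.\<close>
  have "(B * A') * (B' * A) = 1\<^sub>m n" "(B' * A) * (B * A') = 1\<^sub>m n"
    using A B A' B' AB AB' by (simp_all add: square_mat_simps[where m=n])
  moreover have "\<phi> T = (c' / c) \<cdot>\<^sub>m ((B * A') * map_mat \<tau> T * (B' * A))" if T: "T \<in> carrier_mat n n" for T
  proof -
    have "B * (c \<cdot>\<^sub>m (A * \<phi> T * B)) * A = c \<cdot>\<^sub>m \<phi> T"
      using A B AB \<phi>[OF T] by (simp add: square_mat_simps[where m=n])
    moreover have "B * (c' \<cdot>\<^sub>m (A' * map_mat \<tau> T * B')) * A = c' \<cdot>\<^sub>m ((B * A') * map_mat \<tau> T * (B' * A))"
      using A B A' B' T by (simp add: square_mat_simps[where m=n])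
    ultimately have *: "c \<cdot>\<^sub>m \<phi> T = c' \<cdot>\<^sub>m ((B * A') * map_mat \<tau> T * (B' * A))" using eq[OF T] by simp
    show ?thesis
    proof (rule eq_matI)
      fix i j assume "i < dim_row ((c' / c) \<cdot>\<^sub>m ((B * A') * map_mat \<tau> T * (B' * A)))"
        "j < dim_col ((c' / c) \<cdot>\<^sub>m ((B * A') * map_mat \<tau> T * (B' * A)))"
      then have ij: "i < n" "j < n" using A B by auto
      have "c * \<phi> T $$ (i, j) = c' * ((B * A') * map_mat \<tau> T * (B' * A)) $$ (i, j)"
        using arg_cong[OF *, of "\<lambda>M. M $$ (i, j)"] ij A B \<phi>[OF T]
        by (simp del: index_mult_mat(1) assoc_mult_mat)
      then show "\<phi> T $$ (i, j) = ((c' / c) \<cdot>\<^sub>m ((B * A') * map_mat \<tau> T * (B' * A))) $$ (i, j)"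
        using ij A B c by (simp add: field_simps del: index_mult_mat(1) assoc_mult_mat)
    qed (use A B \<phi>[OF T] in auto)
  qed
  ultimately show ?thesis
    unfolding semilinear_conjugation_def using A B A' B' \<tau> mult_carrier_mat by metis
qed

context unital_quad_preserver
begin

text \<open>The images of the diagonal units are n nonzero mutually orthogonal idempotents. One
  nonzero column and one scaled row of each suffice: orthogonality makes the two resulting matrices
  inverse to each other, without any appeal to rank.\<close>

lemma simultaneous_diagonalization:
  obtains A B where "A \<in> C" "B \<in> C" "A * B = One" "B * A = One"
    "\<And>i. i < n \<Longrightarrow> B * \<phi> (mat_unit n i i) * A = mat_unit n i i"
proof -
  define P where "P i = \<phi> (mat_unit n i i)" for i
  have P [simp]: "P i \<in> C" for i by (simp add: P_def)
  have Pdim [simp]: "dim_row (P i) = n" "dim_col (P i) = n" for i by (simp_all add: P_def)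
  have ortho: "P i * P j = (if i = j then P i else Null)" if ij: "i < n" "j < n" for i j
  proof (cases "i = j")
    case True
    then show ?thesis using ij by (simp add: P_def phi_idempotent mat_unit_idempotent)
  next
    case False
    have "mat_unit n i i * mat_unit n j j = Null"
      using ij False by (intro eq_matI) (auto simp: mat_unit_mult_left simp del: index_mult_mat(1))
    then show ?thesis
      using False phi_left_annihilate[of "mat_unit n i i" "mat_unit n j j"] ij
      by (simp add: P_def mat_unit_idempotent)
  qed
  have "\<exists>r c. r < n \<and> c < n \<and> P i $$ (r, c) \<noteq> 0" if i: "i < n" for i
  proof -
    have "P i \<noteq> Null" using i by (simp add: P_def phi_eq_zero_iff mat_unit_neq_zero)
    then show ?thesis by (auto elim: mat_neqD[of "P i" Null])
  qed
  then obtain r c where rc: "\<And>i. i < n \<Longrightarrow> r i < n" "\<And>i. i < n \<Longrightarrow> c i < n"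
    "\<And>i. i < n \<Longrightarrow> P i $$ (r i, c i) \<noteq> 0" by metis
  \<comment> \<open>Columns and rows of the \<open>P i\<close>, paired so that \<open>B * A\<close> reads off entries of the products \<open>P i * P j\<close>.\<close>
  define A where "A = mat n n (\<lambda>(a, i). P i $$ (a, c i))"
  define B where "B = mat n n (\<lambda>(i, b). P i $$ (r i, b) / P i $$ (r i, c i))"
  have A: "A \<in> C" and B: "B \<in> C" by (simp_all add: A_def B_def)
  have BA: "B * A = One"
  proof (rule eq_matI)
    fix i j assume "i < dim_row One" "j < dim_col One"
    then have ij: "i < n" "j < n" by auto
    have "(B * A) $$ (i, j) = (\<Sum>k<n. P i $$ (r i, k) * P j $$ (k, c j) / P i $$ (r i, c i))"
      unfolding index_mult_sum[OF B A ij] using ij by (intro sum.cong) (auto simp: A_def B_def)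
    also have "\<dots> = (P i * P j) $$ (r i, c j) / P i $$ (r i, c i)"
      using ij rc by (simp add: index_mult_sum[of _ n] sum_divide_distrib del: index_mult_mat(1))
    also have "\<dots> = One $$ (i, j)" using ij rc by (simp add: ortho)
    finally show "(B * A) $$ (i, j) = One $$ (i, j)" .
  qed (auto simp: A_def B_def)
  have AB: "A * B = One" by (rule mat_mult_left_right_inverse[OF B A BA])
  have "B * P i * A = mat_unit n i i" if i: "i < n" for i
  proof -
    \<comment> \<open>Each column of \<open>A\<close> is a column of its own idempotent
      \<open>P j\<close>, so \<open>P i\<close> fixes it when i = j and kills it otherwise.\<close>
    have "P i * A = A * mat_unit n i i"
    proof (rule eq_matI)
      fix a j assume "a < dim_row (A * mat_unit n i i)" "j < dim_col (A * mat_unit n i i)"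
      then have aj: "a < n" "j < n" by (auto simp: A_def)
      have "(P i * A) $$ (a, j) = (\<Sum>k<n. P i $$ (a, k) * P j $$ (k, c j))"
        unfolding index_mult_sum[OF P A aj] using aj by (intro sum.cong) (auto simp: A_def)
      also have "\<dots> = (P i * P j) $$ (a, c j)"
        using aj rc by (simp add: index_mult_sum[of _ n] del: index_mult_mat(1))
      also have "\<dots> = (A * mat_unit n i i) $$ (a, j)"
        using aj i rc A by (simp add: ortho mat_unit_mult_right del: index_mult_mat(1)) (simp add: A_def)
      finally show "(P i * A) $$ (a, j) = (A * mat_unit n i i) $$ (a, j)" .
    qed (auto simp: A_def)
    then have "B * P i * A = (B * A) * mat_unit n i i" using A B by (simp add: sq)
    then show ?thesis by (simp add: BA)
  qed
  then show ?thesis using that[OF A B AB BA] by (simp add: P_def)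
qed

lemma semilinear_unital: "semilinear_conjugation n \<phi>"
proof -
  obtain A B where A: "A \<in> C" and B: "B \<in> C" and AB: "A * B = One" "B * A = One"
    and diag: "\<And>i. i < n \<Longrightarrow> B * \<phi> (mat_unit n i i) * A = mat_unit n i i"
    using simultaneous_diagonalization by blast
  interpret d: quad_preserver n "\<lambda>X. 1 \<cdot>\<^sub>m (B * \<phi> X * A)"
    by (rule conjugate[OF B A AB(2,1)]) simp
  interpret d: diagonal_quad_preserver n "\<lambda>X. 1 \<cdot>\<^sub>m (B * \<phi> X * A)"
    by unfold_locales (use A B AB diag in simp_all)
  show ?thesis
    by (rule semilinear_conjugation_of_conjugate[OF B A AB(2,1) _ _ d.semilinear]) simp_all
qed

end

lemma (in quad_preserver) semilinear_conjugation: "semilinear_conjugation n \<phi>"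
proof -
  obtain c where c: "c \<noteq> 0" "\<phi> One = c \<cdot>\<^sub>m One" using phi_one_scalar by blast
  \<comment> \<open>Only the division by \<open>c\<close> matters; the factors \<open>One\<close>
    give the map the shape that \<open>conjugate\<close> expects.\<close>
  interpret u: quad_preserver n "\<lambda>X. (1 / c) \<cdot>\<^sub>m (One * \<phi> X * One)"
    by (rule conjugate) (use c in simp_all)
  interpret u: unital_quad_preserver n "\<lambda>X. (1 / c) \<cdot>\<^sub>m (One * \<phi> X * One)"
    by unfold_locales (use c in \<open>auto intro!: eq_matI\<close>)
  show ?thesis
    by (rule semilinear_conjugation_of_conjugate[OF _ _ _ _ _ _ u.semilinear_unital]) (use c in simp_all)
qed

section \<open>The cycle of implications over a field of characteristic 0\<close>

lemma quadratic_preserver_equivalence: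
  fixes \<phi> :: "'a::field_char_0 mat \<Rightarrow> 'a mat"
  assumes n: "n \<ge> 3" and bij: "bij_betw \<phi> (carrier_mat n n) (carrier_mat n n)"
  shows "((\<forall>k\<ge>1. \<forall>T\<in>block_carrier n k.
         quadratic_mat (block_mat n T) \<longleftrightarrow> quadratic_mat (block_mat n (ampl \<phi> T)))
      \<longleftrightarrow> (\<forall>T\<in>block_carrier n 2.
         quadratic_mat (block_mat n T) \<longleftrightarrow> quadratic_mat (block_mat n (ampl \<phi> T))))
    \<and> ((\<forall>T\<in>block_carrier n 2.
         quadratic_mat (block_mat n T) \<longleftrightarrow> quadratic_mat (block_mat n (ampl \<phi> T)))
      \<longleftrightarrow> semilinear_conjugation n \<phi>)" (is "(?all \<longleftrightarrow> ?two) \<and> (?two \<longleftrightarrow> ?semi)")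
proof -
  have "?all \<Longrightarrow> ?two" by (meson one_le_numeral)
  moreover have ?semi if two: ?two
  proof -
    have \<phi>: "\<phi> X \<in> carrier_mat n n" if "X \<in> carrier_mat n n" for X
      using bij that by (auto simp: bij_betw_def)
    interpret quad_preserver n \<phi>
    proof
      fix X Y Z W :: "'a mat"
      assume C: "X \<in> carrier_mat n n" "Y \<in> carrier_mat n n" "Z \<in> carrier_mat n n" "W \<in> carrier_mat n n"
      show "quad n (\<phi> X) (\<phi> Y) (\<phi> Z) (\<phi> W) \<longleftrightarrow> quad n X Y Z W"
        using two blocks_carrier[OF C] C \<phi> by (simp add: ampl_blocks flip: quadratic_blocks_iff)
    qed (use n bij in auto)
    show ?thesis by (rule semilinear_conjugation)
  qed
  moreover have ?all if ?semi
    using semilinear_conjugation_quadratic_iff[OF _ that bij_betw_imp_inj_on[OF bij]] n by simp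
  ultimately show ?thesis by blast
qed

theorem theorem1p2:
  fixes n :: nat
    and \<phi>R :: "real mat \<Rightarrow> real mat"
    and \<phi>C :: "complex mat \<Rightarrow> complex mat"
  assumes "n \<ge> 3"
    and "bij_betw \<phi>R (carrier_mat n n) (carrier_mat n n)"
    and "bij_betw \<phi>C (carrier_mat n n) (carrier_mat n n)"
  shows
   "((\<forall>k\<ge>1. \<forall>T\<in>block_carrier n k.
         quadratic_mat (block_mat n T) \<longleftrightarrow> quadratic_mat (block_mat n (ampl \<phi>R T)))
      \<longleftrightarrow> (\<forall>T\<in>block_carrier n 2.
         quadratic_mat (block_mat n T) \<longleftrightarrow> quadratic_mat (block_mat n (ampl \<phi>R T))))
    \<and> ((\<forall>T\<in>block_carrier n 2.
         quadratic_mat (block_mat n T) \<longleftrightarrow> quadratic_mat (block_mat n (ampl \<phi>R T)))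
      \<longleftrightarrow> (\<exists>A\<in>carrier_mat n n. \<exists>B\<in>carrier_mat n n. \<exists>c \<tau>.
            A * B = 1\<^sub>m n \<and> B * A = 1\<^sub>m n \<and> field_automorphism \<tau> \<and>
            (\<forall>T\<in>carrier_mat n n. \<phi>R T = c \<cdot>\<^sub>m (A * map_mat \<tau> T * B))))
    \<and> ((\<forall>k\<ge>1. \<forall>T\<in>block_carrier n k.
         quadratic_mat (block_mat n T) \<longleftrightarrow> quadratic_mat (block_mat n (ampl \<phi>C T)))
      \<longleftrightarrow> (\<forall>T\<in>block_carrier n 2.
         quadratic_mat (block_mat n T) \<longleftrightarrow> quadratic_mat (block_mat n (ampl \<phi>C T))))
    \<and> ((\<forall>T\<in>block_carrier n 2.
         quadratic_mat (block_mat n T) \<longleftrightarrow> quadratic_mat (block_mat n (ampl \<phi>C T)))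
      \<longleftrightarrow> (\<exists>A\<in>carrier_mat n n. \<exists>B\<in>carrier_mat n n. \<exists>c \<tau>.
            A * B = 1\<^sub>m n \<and> B * A = 1\<^sub>m n \<and> field_automorphism \<tau> \<and>
            (\<forall>T\<in>carrier_mat n n. \<phi>C T = c \<cdot>\<^sub>m (A * map_mat \<tau> T * B))))"
  using quadratic_preserver_equivalence[OF assms(1,2), unfolded semilinear_conjugation_def]
    quadratic_preserver_equivalence[OF assms(1,3), unfolded semilinear_conjugation_def]
  by (intro conjI) (elim conjE, assumption)+

end
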